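(* Fix a real number $p>0$. (i) As $d,n\to\infty$ with $n=\omega(d^{1+p}\log d)$, $$M_n^p(S^{d-1}) = n\,\mu_{d,p} + o\!\left(n\,d^{-p/2}\right).$$ That is, for every sequence of pairs of positive integers $(d_k,n_k)_{k\ge 1}$ with $d_k\to\infty$, $n_k\to\infty$ and $n_k/(d_k^{1+p}\log d_k)\to\infty$, one has $$\lim_{k\to\infty}\frac{\left|M_{n_k}^p(S^{d_k-1})-n_k\,\mu_{d_k,p}\right|}{n_k\,d_k^{-p/2}}=0.$$ (ii) If $0<p\le 2$, then $M_n^p(S^{d-1})=\Theta(n\,d^{-p/2})$ as $d,n\to\infty$ with $n\ge d$. That is, there exist constants $c,C>0$ and $N$ depending only on $p$ such that $c\,n\,d^{-p/2}\le M_n^p(S^{d-1})\le C\,n\,d^{-p/2}$ for all integers $n\ge d\ge N$. (iii) If $p>2$, then $M_n^p(S^{d-1})=\Omega(n\,d^{-p/2})$ and $M_n^p(S^{d-1})=O(n\,d^{-1})$ as $d,n\to\infty$ with $n\ge d$. That is, there exist constants $c,C>0$ and $N$ depending only on $p$ such that $c\,n\,d^{-p/2}\le M_n^p(S^{d-1})\le C\,n\,d^{-1}$ for all integers $n\ge d\ge N$.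
   Context: $S^{d-1}$ is the Euclidean unit sphere in $\mathbb{R}^d$ and $\langle\cdot,\cdot\rangle$ is the standard inner product. For a multiset $\omega_n=\{u_1,\dots,u_n\}$ of $n$ unit vectors in $\mathbb{R}^d$ (repetitions allowed) and $p>0$, the $\ell_p$-potential at $v\in S^{d-1}$ is $U^p(\omega_n,v)=\sum_{i=1}^n|\langle v,u_i\rangle|^p$, and the $\ell_p$-polarization of $\omega_n$ is $M^p(\omega_n)=\max_{v\in S^{d-1}}U^p(\omega_n,v)$. The $n$th $\ell_p$-polarization constant of $S^{d-1}$ is $$M_n^p(S^{d-1})=\min_{u_1,\dots,u_n\in S^{d-1}}\ \max_{v\in S^{d-1}}\ \sum_{i=1}^n|\langle v,u_i\rangle|^p .$$ Moreover, $$\mu_{d,p}=\frac{\Gamma\left(\frac d2\right)\Gamma\left(\frac{p+1}{2}\right)}{\sqrt{\pi}\,\Gamma\left(\frac{d+p}{2}\right)}.$$ *)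

theory Defs
  imports "HOL-Analysis.Analysis"
begin

text \<open>The dimension varies within the statement, so points of $\mathbb{R}^d$ are functions
  \<open>nat \<Rightarrow> real\<close> vanishing from index \<open>d\<close> on, i.e. elements of
  \<^term>\<open>topspace (Euclidean_space d)\<close>.\<close>

definition unit_sphere :: "nat \<Rightarrow> (nat \<Rightarrow> real) set" where
  "unit_sphere d = {x \<in> topspace (Euclidean_space d). (\<Sum>i<d. (x i)\<^sup>2) = 1}"

lemma unit_sphere_Suc_eq_nsphere: "unit_sphere (Suc m) = topspace (nsphere m)"
  by (auto simp: unit_sphere_def nsphere topspace_Euclidean_space lessThan_Suc_atMost)

definition dot :: "nat \<Rightarrow> (nat \<Rightarrow> real) \<Rightarrow> (nat \<Rightarrow> real) \<Rightarrow> real" where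
  "dot d x y = (\<Sum>i<d. x i * y i)"

text \<open>A multiset of \<open>n\<close> vectors is represented by an enumeration \<open>u 0, \<dots>, u (n - 1)\<close>, so
  repetitions are allowed.\<close>

definition lp_potential ::
    "real \<Rightarrow> nat \<Rightarrow> nat \<Rightarrow> (nat \<Rightarrow> nat \<Rightarrow> real) \<Rightarrow> (nat \<Rightarrow> real) \<Rightarrow> real" where
  "lp_potential p d n u v = (\<Sum>i<n. \<bar>dot d v (u i)\<bar> powr p)"

definition lp_polarization :: "real \<Rightarrow> nat \<Rightarrow> nat \<Rightarrow> (nat \<Rightarrow> nat \<Rightarrow> real) \<Rightarrow> real" where
  "lp_polarization p d n u = (SUP v\<in>unit_sphere d. lp_potential p d n u v)"

definition polarization_const :: "real \<Rightarrow> nat \<Rightarrow> nat \<Rightarrow> real" where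
  "polarization_const p d n =
     (INF u\<in>{..<n} \<rightarrow>\<^sub>E unit_sphere d. lp_polarization p d n u)"

definition mu :: "nat \<Rightarrow> real \<Rightarrow> real" where
  "mu d p = Gamma (real d / 2) * Gamma ((p + 1) / 2) / (sqrt pi * Gamma ((real d + p) / 2))"

text \<open>For \<open>p > 0\<close> and \<open>d > 0\<close> the supremum and the infimum above are attained, i.e. they are the
  maximum and the minimum: see \<open>lp_polarization_attained\<close> and \<open>polarization_const_attained\<close>.\<close>

lemma unit_sphere_nonempty:
  assumes "d > 0" shows "unit_sphere d \<noteq> {}"
proof -
  have "(\<Sum>i<d. (if i = 0 then 1 else 0 :: real)\<^sup>2) = (\<Sum>i<d. if i = 0 then 1 else 0)"
    by (intro sum.cong) auto
  also have "\<dots> = 1" using assms by simp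
  finally have "(\<lambda>i. if i = 0 then 1 else 0) \<in> unit_sphere d"
    using assms by (auto simp: unit_sphere_def topspace_Euclidean_space)
  then show ?thesis by blast
qed

lemma compact_PiE_UNIV:
  fixes S :: "nat \<Rightarrow> 'b::topological_space set"
  assumes "\<And>i. compact (S i)"
  shows "compact (PiE UNIV S)"
proof -
  have "compactin (product_topology (\<lambda>_. euclidean) UNIV) (PiE UNIV S)"
    unfolding compactin_PiE using assms by simp
  then show ?thesis
    unfolding euclidean_product_topology compactin_euclidean_iff .
qed

lemma compact_unit_sphere: "compact (unit_sphere d)"
proof -
  have eq: "unit_sphere d = PiE UNIV (\<lambda>i. if i < d then {-1..1} else {0}) \<inter>
      {x. (\<Sum>i<d. (x i)\<^sup>2) = 1}"
  proof -
    have "\<bar>x i\<bar> \<le> 1" if "(\<Sum>i<d. (x i)\<^sup>2) = 1" "i < d" for x :: "nat \<Rightarrow> real" and i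
    proof -
      have "(x i)\<^sup>2 \<le> (\<Sum>i<d. (x i)\<^sup>2)"
        by (rule member_le_sum) (use that in auto)
      then show ?thesis using that by (simp add: abs_square_le_1)
    qed
    then have "x i \<le> 1 \<and> - 1 \<le> x i" if "(\<Sum>i<d. (x i)\<^sup>2) = 1" "i < d"
      for x :: "nat \<Rightarrow> real" and i
      using that by (simp add: abs_le_iff minus_le_iff)
    moreover have "x \<in> PiE UNIV (\<lambda>i. if i < d then {-1..1} else {0}) \<longleftrightarrow>
        (\<forall>i<d. x i \<le> 1 \<and> - 1 \<le> x i) \<and> (\<forall>i\<ge>d. x i = 0)" for x :: "nat \<Rightarrow> real"
      by (auto simp: Pi_iff split: if_splits)
    ultimately show ?thesis
      unfolding unit_sphere_def topspace_Euclidean_space by (intro set_eqI) (simp, blast)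
  qed
  have "closed {x :: nat \<Rightarrow> real. (\<Sum>i<d. (x i)\<^sup>2) = 1}"
    by (intro closed_Collect_eq continuous_on_sum continuous_on_power continuous_on_const
          continuous_on_product_coordinates)
  moreover have "compact (PiE UNIV (\<lambda>i. if i < d then {-1..1} else {0 :: real}))"
    by (rule compact_PiE_UNIV) simp
  ultimately show ?thesis
    unfolding eq by (rule compact_Int_closed[rotated])
qed

lemma continuous_on_abs_dot_powr:
  fixes x y :: "'a::topological_space \<Rightarrow> nat \<Rightarrow> real"
  assumes "p > 0" "\<And>i. continuous_on A (\<lambda>a. x a i)" "\<And>i. continuous_on A (\<lambda>a. y a i)"
  shows "continuous_on A (\<lambda>a. \<bar>dot d (x a) (y a)\<bar> powr p)"
proof (rule continuous_on_powr')
  show "continuous_on A (\<lambda>a. \<bar>dot d (x a) (y a)\<bar>)"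
    unfolding dot_def by (intro continuous_on_rabs continuous_on_sum continuous_on_mult assms)
qed (use assms(1) in auto)

lemma lp_polarization_attained:
  assumes "p > 0" "d > 0"
  shows "\<exists>v\<in>unit_sphere d. lp_polarization p d n u = lp_potential p d n u v \<and>
           (\<forall>w\<in>unit_sphere d. lp_potential p d n u w \<le> lp_potential p d n u v)"
proof -
  have coord: "continuous_on (unit_sphere d) (\<lambda>v. v i)" for i
    by (rule continuous_on_subset[OF continuous_on_product_coordinates]) simp
  have "continuous_on (unit_sphere d) (lp_potential p d n u)"
    unfolding lp_potential_def[abs_def]
    by (intro continuous_on_sum continuous_on_abs_dot_powr assms coord continuous_on_const)
  then obtain v where v: "v \<in> unit_sphere d"
      "\<forall>w\<in>unit_sphere d. lp_potential p d n u w \<le> lp_potential p d n u v"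
    using continuous_attains_sup[OF compact_unit_sphere unit_sphere_nonempty[OF assms(2)]]
    by blast
  then have "lp_polarization p d n u = lp_potential p d n u v"
    unfolding lp_polarization_def by (intro cSup_eq_maximum) auto
  with v show ?thesis by blast
qed

lemma polarization_const_attained:
  assumes p: "p > 0" and d: "d > 0"
  shows "\<exists>u\<in>{..<n} \<rightarrow>\<^sub>E unit_sphere d. polarization_const p d n = lp_polarization p d n u \<and>
           (\<forall>w\<in>{..<n} \<rightarrow>\<^sub>E unit_sphere d. lp_polarization p d n u \<le> lp_polarization p d n w)"
proof -
  define K where "K = {..<n} \<rightarrow>\<^sub>E unit_sphere d"
  define m where "m = polarization_const p d n"
  define C where "C k = {u \<in> K. lp_polarization p d n u \<le> m + 1 / real (Suc k)}" for k :: nat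
  have K_eq: "K = PiE UNIV (\<lambda>i. if i < n then unit_sphere d else {undefined})"
    unfolding K_def set_eq_iff PiE_iff extensional_def
    by (simp add: all_conj_distrib if_distribR conj_commute Ball_def)
  have K_compact: "compact K"
    unfolding K_eq by (rule compact_PiE_UNIV) (simp add: compact_unit_sphere)
  have K_ne: "K \<noteq> {}"
    using unit_sphere_nonempty[OF d] by (auto simp: K_def PiE_eq_empty_iff)
  have ge: "lp_potential p d n u v \<le> lp_polarization p d n u" if "v \<in> unit_sphere d" for u v
    using lp_polarization_attained[OF p d, of n u] that by auto
  have le_iff: "lp_polarization p d n u \<le> a \<longleftrightarrow> (\<forall>v\<in>unit_sphere d. lp_potential p d n u v \<le> a)"
    for u a
    using lp_polarization_attained[OF p d, of n u] by auto
  have nonneg: "0 \<le> lp_polarization p d n u" for u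
  proof -
    obtain v where "lp_polarization p d n u = lp_potential p d n u v"
      using lp_polarization_attained[OF p d, of n u] by blast
    then show ?thesis by (simp add: lp_potential_def sum_nonneg)
  qed
  have bdd: "bdd_below (lp_polarization p d n ` K)"
    using nonneg by (intro bdd_belowI[of _ 0]) auto
  have lower: "m \<le> lp_polarization p d n u" if "u \<in> K" for u
    unfolding m_def polarization_const_def K_def[symmetric]
    by (intro cINF_lower bdd that)
  have C_compact: "compact (C k)" for k
  proof -
    have cont: "continuous_on UNIV (\<lambda>u :: nat \<Rightarrow> nat \<Rightarrow> real. u i j)" for i j
      using continuous_on_compose2[OF continuous_on_product_coordinates[of j]
              continuous_on_product_coordinates[of i]] by auto
    have "closed {u. lp_potential p d n u v \<le> a}" for v a
      unfolding lp_potential_def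
      by (intro closed_Collect_le continuous_on_sum continuous_on_abs_dot_powr p cont
            continuous_on_const)
    then have "closed (\<Inter>v\<in>unit_sphere d. {u. lp_potential p d n u v \<le> m + 1 / real (Suc k)})"
      by (intro closed_INT) auto
    moreover have "C k = K \<inter> (\<Inter>v\<in>unit_sphere d.
        {u. lp_potential p d n u v \<le> m + 1 / real (Suc k)})"
      by (auto simp: C_def le_iff)
    ultimately show ?thesis using K_compact by (simp add: compact_Int_closed)
  qed
  have C_ne: "C k \<noteq> {}" for k
  proof -
    have "(INF u\<in>K. lp_polarization p d n u) < m + 1 / real (Suc k)"
      by (simp add: m_def polarization_const_def K_def)
    then obtain u where "u \<in> K" "lp_polarization p d n u < m + 1 / real (Suc k)"
      using cINF_less_iff[OF K_ne bdd] by blast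
    then show ?thesis by (auto simp: C_def intro: less_imp_le)
  qed
  have C_mono: "C k \<subseteq> C j" if "j \<le> k" for j k
  proof -
    have "1 / real (Suc k) \<le> 1 / real (Suc j)"
      using that by (intro divide_left_mono) auto
    then show ?thesis by (force simp: C_def)
  qed
  have "K \<inter> (\<Inter>k\<in>UNIV. C k) \<noteq> {}"
  proof (rule compact_imp_fip_image[OF K_compact])
    show "closed (C k)" for k using C_compact by (rule compact_imp_closed)
    show "K \<inter> (\<Inter>k\<in>I. C k) \<noteq> {}" if I: "finite I" for I
    proof -
      have "C (Max (insert 0 I)) \<subseteq> C k" if "k \<in> I" for k
        by (rule C_mono) (use I that in simp)
      moreover have "C k \<subseteq> K" for k by (auto simp: C_def)
      ultimately have "C (Max (insert 0 I)) \<subseteq> K \<inter> (\<Inter>k\<in>I. C k)" by blast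
      with C_ne show ?thesis by blast
    qed
  qed
  then obtain u where u: "u \<in> C k" for k by blast
  have uK: "u \<in> K" using u[of 0] by (simp add: C_def)
  have "lp_polarization p d n u \<le> m"
  proof (rule field_le_epsilon)
    fix e :: real assume "e > 0"
    then obtain k where "inverse (real (Suc k)) < e" using reals_Archimedean by blast
    then show "lp_polarization p d n u \<le> m + e"
      using u[of k] by (simp add: C_def inverse_eq_divide)
  qed
  with lower uK have "m = lp_polarization p d n u" by (simp add: antisym)
  then show ?thesis using uK lower unfolding m_def K_def by metis
qed

end

theory Submission
  imports Defs "HOL-Probability.Probability"
begin

text \<open>Lower bound: average the potential over a uniformly random direction \<open>v\<close>; each of the \<open>n\<close> terms
  has mean \<open>mu d p\<close>, and \<open>mu d p\<close> has order \<open>d powr (- p / 2)\<close> by log-convexity of \<open>Gamma\<close>.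
  Upper bound for \<open>n\<close> large: take the \<open>u i\<close> to be independent uniform directions. By Hoeffding's
  inequality the potential at a fixed \<open>v\<close> exceeds its mean by \<open>n * \<delta>\<close> with probability at most
  \<open>exp (- 2 * n * \<delta>\<^sup>2)\<close>; with \<open>\<delta> = e * d powr (- p / 2)\<close> this beats the \<open>exp (O (d * ln d))\<close> points of a
  net of polynomially small mesh, and the potential is Hoelder continuous in \<open>v\<close>.
  Upper bound for all \<open>n \<ge> d\<close>: repeat the standard basis.

  A uniform direction is \<open>x / |x|\<close> for a standard Gaussian \<open>x\<close>. Its moment is obtained without polar
  coordinates: \<open>|x| powr (- p)\<close> is an integral over \<open>t\<close> of \<open>exp (- t * |x|\<^sup>2)\<close>, a factor which only rescales
  the Gaussian, so that a beta integral and the one-dimensional absolute moment remain; the latter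
  is the case \<open>d = 1\<close> of the same identity.\<close>

subsection \<open>Gaussian measures\<close>

text \<open>Substitution of \<open>r * t\<close> for the variable in Euler's integral. Read from
  right to left it writes \<open>r powr (- s)\<close> as a superposition of exponentials in
  \<open>r\<close>, which is how negative powers of the norm are treated below.\<close>

lemma nn_integral_Gamma_scaled:
  fixes s r :: real
  assumes "s > 0" "r > 0"
  shows "(\<integral>\<^sup>+t. ennreal (indicator {0..} t * t powr (s - 1) * exp (- (t * r))) \<partial>lborel)
    = ennreal (Gamma s * r powr (- s))"
proof -
  have "ennreal (Gamma s) = (\<integral>\<^sup>+t. ennreal (indicator {0..} t * t powr (s - 1) / exp t) \<partial>lborel)"
    by (rule Gamma_conv_nn_integral_real[OF assms(1)])
  also have "\<dots> = ennreal \<bar>r\<bar> * (\<integral>\<^sup>+t. ennreal (indicator {0..} (0 + r * t) * (0 + r * t) powr (s - 1) / exp (0 + r * t)) \<partial>lborel)"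
    by (rule nn_integral_real_affine) (use assms in auto)
  also have "(\<lambda>t. ennreal (indicator {0..} (0 + r * t) * (0 + r * t) powr (s - 1) / exp (0 + r * t)))
     = (\<lambda>t. ennreal (r powr (s - 1)) * ennreal (indicator {0..} t * t powr (s - 1) * exp (- (t * r))))"
    using assms by (intro ext)
      (auto simp: indicator_def powr_mult zero_le_mult_iff exp_minus field_simps simp flip: ennreal_mult)
  also have "(\<integral>\<^sup>+t. ennreal (r powr (s - 1)) * ennreal (indicator {0..} t * t powr (s - 1) * exp (- (t * r))) \<partial>lborel)
    = ennreal (r powr (s - 1)) * (\<integral>\<^sup>+t. ennreal (indicator {0..} t * t powr (s - 1) * exp (- (t * r))) \<partial>lborel)"
    (is "_ = _ * ?I") by (rule nn_integral_cmult) auto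
  also have "ennreal \<bar>r\<bar> * (ennreal (r powr (s - 1)) * ?I) = ennreal (r powr s) * ?I"
    using assms by (simp add: powr_diff mult.assoc[symmetric] flip: ennreal_mult)
  \<comment> \<open>\<open>?I\<close> is an extended nonnegative real, so the factor
    \<open>r powr s\<close> is removed by multiplying with its inverse.\<close>
  finally have "ennreal (r powr (- s)) * ennreal (Gamma s) = ennreal (r powr (- s)) * (ennreal (r powr s) * ?I)"
    by simp
  also have "\<dots> = ?I" 
    using assms by (simp add: mult.assoc[symmetric] flip: ennreal_mult powr_add)
  finally show ?thesis using assms
    by (simp add: mult.commute flip: ennreal_mult)
qed

abbreviation normal_measure :: "real \<Rightarrow> real measure" where
  "normal_measure \<sigma> \<equiv> density lborel (\<lambda>x. ennreal (normal_density 0 \<sigma> x))"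

text \<open>The deviation is a parameter because a factor exp(-t|x|^2) turns the standard Gaussian
  into a multiple of one with another deviation; the index set is arbitrary to allow induction over
  it.\<close>

definition gaussian :: "'i set \<Rightarrow> real \<Rightarrow> ('i \<Rightarrow> real) measure" where
  "gaussian I \<sigma> = PiM I (\<lambda>_. normal_measure \<sigma>)"

lemma space_gaussian: "space (gaussian I \<sigma>) = I \<rightarrow>\<^sub>E UNIV"
  by (simp add: gaussian_def space_PiM)

lemma sets_gaussian [measurable_cong]: "sets (gaussian I \<sigma>) = sets (PiM I (\<lambda>_. borel))"
  unfolding gaussian_def by (rule sets_PiM_cong) auto

lemma prob_space_gaussian: "\<sigma> > 0 \<Longrightarrow> prob_space (gaussian I \<sigma>)"
  unfolding gaussian_def by (intro prob_space_PiM prob_space_normal_density)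

text \<open>With s = (1 + 2t)^(-1/2) one has 1/2 + t = 1/(2 s^2), so the exponents agree; the factor
  s compensates the normalisation of the density with deviation s.\<close>

lemma normal_tilt:
  fixes t :: real
  assumes "t \<ge> 0"
  shows "normal_density 0 1 x * exp (- (t * x\<^sup>2))
    = (1 + 2 * t) powr (- 1/2) * normal_density 0 ((1 + 2 * t) powr (- 1/2)) x"
proof -
  define s where "s = (1 + 2 * t) powr (- 1/2)"
  have s: "s > 0" using assms by (simp add: s_def)
  have a: "s\<^sup>2 = 1 / (1 + 2 * t)"
    using assms by (simp add: s_def power2_eq_square powr_minus_divide flip: powr_add)
  have "normal_density 0 1 x * exp (- (t * x\<^sup>2)) = 1 / sqrt (2 * pi) * exp (- x\<^sup>2 / 2 - t * x\<^sup>2)"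
    by (simp add: normal_density_def flip: exp_add)
  also have "- x\<^sup>2 / 2 - t * x\<^sup>2 = - x\<^sup>2 / (2 * s\<^sup>2)"
    unfolding a using assms by (simp add: field_simps)
  also have "1 / sqrt (2 * pi) * exp (- x\<^sup>2 / (2 * s\<^sup>2)) = s * normal_density 0 s x"
    using s by (simp add: normal_density_def real_sqrt_mult)
  finally show ?thesis unfolding s_def .
qed

text \<open>The weight is a product over the coordinates, so each coordinate is tilted separately by
  \<open>normal_tilt\<close> and contributes one factor (1 + 2t)^(-1/2).\<close>

lemma nn_integral_gaussian_tilt:
  fixes t :: real and f :: "('i \<Rightarrow> real) \<Rightarrow> ennreal"
  assumes "finite I" "t \<ge> 0" "f \<in> borel_measurable (PiM I (\<lambda>_. borel))"
  shows "(\<integral>\<^sup>+x. f x * ennreal (exp (- (t * (\<Sum>i\<in>I. (x i)\<^sup>2)))) \<partial>gaussian I 1)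
    = ennreal ((1 + 2 * t) powr (- real (card I) / 2)) * (\<integral>\<^sup>+x. f x \<partial>gaussian I ((1 + 2 * t) powr (- 1/2)))"
  using assms(1,3)
proof (induction I arbitrary: f)
  case empty
  have *: "(\<integral>\<^sup>+x. g x \<partial>gaussian {} \<sigma>) = g (\<lambda>_. undefined)" for g :: "('i \<Rightarrow> real) \<Rightarrow> ennreal" and \<sigma>
    unfolding gaussian_def PiM_empty by (subst nn_integral_count_space_finite) simp_all
  show ?case unfolding * using \<open>t \<ge> 0\<close> by simp
next
  case (insert i I)
  define \<sigma> where "\<sigma> = (1 + 2 * t) powr (- 1/2)"
  have \<sigma>: "\<sigma> > 0" using \<open>t \<ge> 0\<close> by (simp add: \<sigma>_def)
  interpret N1: product_sigma_finite "\<lambda>_. normal_measure 1"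
    by (intro product_sigma_finite.intro prob_space_imp_sigma_finite prob_space_normal_density) simp
  interpret N\<sigma>: product_sigma_finite "\<lambda>_. normal_measure \<sigma>"
    by (intro product_sigma_finite.intro prob_space_imp_sigma_finite prob_space_normal_density \<sigma>)
  have fN: "f \<in> borel_measurable (PiM (insert i I) (\<lambda>_. normal_measure \<sigma>))" for \<sigma>
  proof -
    have "borel_measurable (PiM (insert i I) (\<lambda>_. normal_measure \<sigma>)) = borel_measurable (PiM (insert i I) (\<lambda>_. borel))"
      by (intro measurable_cong_sets sets_PiM_cong) auto
    with insert.prems show ?thesis by blast
  qed
  have upd: "(\<lambda>(x, y). f (x(i := y))) \<in> borel_measurable (PiM I (\<lambda>_. borel) \<Otimes>\<^sub>M borel)"
  proof -
    have "(\<lambda>z. (fst z)(i := snd z)) \<in> PiM I (\<lambda>_. borel) \<Otimes>\<^sub>M borel \<rightarrow>\<^sub>M PiM (insert i I) (\<lambda>_. borel :: real measure)"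
      by (rule measurable_fun_upd[where J = I]) auto
    from measurable_compose[OF this insert.prems] show ?thesis unfolding split_beta' .
  qed
  \<comment> \<open>The induction hypothesis will be applied to this partial integral, in which the
    new coordinate is already tilted; hence \<open>f\<close> is arbitrary in the induction.\<close>
  have meas2: "(\<lambda>x. \<integral>\<^sup>+y. f (x(i := y)) \<partial>normal_measure \<sigma>) \<in> borel_measurable (PiM I (\<lambda>_. borel))"
  proof -
    have "(\<lambda>(x, y). f (x(i := y))) \<in> borel_measurable (PiM I (\<lambda>_. borel) \<Otimes>\<^sub>M normal_measure \<sigma>)"
    proof -
      have "sets (PiM I (\<lambda>_. borel) \<Otimes>\<^sub>M normal_measure \<sigma>) = sets (PiM I (\<lambda>_. borel :: real measure) \<Otimes>\<^sub>M borel)"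
        by (intro sets_pair_measure_cong) auto
      from measurable_cong_sets[OF this refl] upd show ?thesis by blast
    qed
    from sigma_finite_measure.borel_measurable_nn_integral[OF N\<sigma>.sigma_finite_measures this] show ?thesis .
  qed
  have inner: "(\<integral>\<^sup>+y. f (x(i := y)) * ennreal (exp (- (t * (\<Sum>j\<in>insert i I. ((x(i := y)) j)\<^sup>2)))) \<partial>normal_measure 1)
     = ennreal \<sigma> * ((\<integral>\<^sup>+y. f (x(i := y)) \<partial>normal_measure \<sigma>) * ennreal (exp (- (t * (\<Sum>j\<in>I. (x j)\<^sup>2)))))"
    if "x \<in> space (gaussian I 1)" for x
  proof -
    have x: "x \<in> space (PiM I (\<lambda>_. borel :: real measure))" using that by (simp add: space_gaussian space_PiM)
    have [measurable]: "(\<lambda>y. f (x(i := y))) \<in> borel_measurable borel"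
      using measurable_compose[OF measurable_Pair1'[OF x] upd] by simp
    define E where "E = exp (- (t * (\<Sum>j\<in>I. (x j)\<^sup>2)))"
    have E: "E \<ge> 0" by (simp add: E_def)
    have s: "(\<Sum>j\<in>insert i I. ((x(i := y)) j)\<^sup>2) = y\<^sup>2 + (\<Sum>j\<in>I. (x j)\<^sup>2)" for y
      using insert.hyps by (auto intro!: sum.cong)
    have e: "exp (- (t * (y\<^sup>2 + (\<Sum>j\<in>I. (x j)\<^sup>2)))) = exp (- (t * y\<^sup>2)) * E" for y
      by (simp add: E_def distrib_left flip: exp_add)
    have "(\<integral>\<^sup>+y. f (x(i := y)) * ennreal (exp (- (t * (\<Sum>j\<in>insert i I. ((x(i := y)) j)\<^sup>2)))) \<partial>normal_measure 1)
      = (\<integral>\<^sup>+y. ennreal (normal_density 0 1 y) * (f (x(i := y)) * ennreal (exp (- (t * y\<^sup>2)) * E)) \<partial>lborel)"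
      
      unfolding s e by (subst nn_integral_density) simp_all
    also have "\<dots> = (\<integral>\<^sup>+y. ennreal \<sigma> * ((ennreal (normal_density 0 \<sigma> y) * f (x(i := y))) * ennreal E) \<partial>lborel)"
    proof (rule nn_integral_cong)
      fix y
      have "ennreal (normal_density 0 1 y) * (f (x(i := y)) * ennreal (exp (- (t * y\<^sup>2)) * E))
        = f (x(i := y)) * ennreal ((normal_density 0 1 y * exp (- (t * y\<^sup>2))) * E)"
        using E by (simp add: ennreal_mult mult_ac)
      also have "\<dots> = f (x(i := y)) * ennreal (\<sigma> * normal_density 0 \<sigma> y * E)"
        by (subst normal_tilt[OF \<open>t \<ge> 0\<close>]) (simp add: \<sigma>_def)
      also have "\<dots> = ennreal \<sigma> * ((ennreal (normal_density 0 \<sigma> y) * f (x(i := y))) * ennreal E)"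
        using \<sigma> E by (simp add: ennreal_mult mult_ac)
      finally show "ennreal (normal_density 0 1 y) * (f (x(i := y)) * ennreal (exp (- (t * y\<^sup>2)) * E)) = \<dots>" .
    qed
    also have "\<dots> = ennreal \<sigma> * ((\<integral>\<^sup>+y. f (x(i := y)) \<partial>normal_measure \<sigma>) * ennreal E)"
      by (simp add: nn_integral_cmult nn_integral_multc nn_integral_density)
    finally show ?thesis unfolding E_def .
  qed
  have "(\<integral>\<^sup>+x. f x * ennreal (exp (- (t * (\<Sum>i\<in>insert i I. (x i)\<^sup>2)))) \<partial>gaussian (insert i I) 1)
     = (\<integral>\<^sup>+x. \<integral>\<^sup>+y. f (x(i := y)) * ennreal (exp (- (t * (\<Sum>j\<in>insert i I. ((x(i := y)) j)\<^sup>2)))) \<partial>normal_measure 1 \<partial>gaussian I 1)"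
    unfolding gaussian_def
  proof (rule N1.product_nn_integral_insert)
    show "(\<lambda>x. f x * ennreal (exp (- (t * (\<Sum>i\<in>insert i I. (x i)\<^sup>2))))) \<in> borel_measurable (PiM (insert i I) (\<lambda>_. normal_measure 1))"
      using fN[of 1] by measurable
  qed (use insert.hyps in auto)
  also have "\<dots> = (\<integral>\<^sup>+x. ennreal \<sigma> * ((\<integral>\<^sup>+y. f (x(i := y)) \<partial>normal_measure \<sigma>) * ennreal (exp (- (t * (\<Sum>j\<in>I. (x j)\<^sup>2))))) \<partial>gaussian I 1)"
    by (intro nn_integral_cong inner)
  also have "\<dots> = ennreal \<sigma> * (\<integral>\<^sup>+x. (\<integral>\<^sup>+y. f (x(i := y)) \<partial>normal_measure \<sigma>) * ennreal (exp (- (t * (\<Sum>j\<in>I. (x j)\<^sup>2)))) \<partial>gaussian I 1)"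
    by (intro nn_integral_cmult) (use meas2 in measurable)
  also have "\<dots> = ennreal \<sigma> * (ennreal ((1 + 2 * t) powr (- real (card I) / 2)) * (\<integral>\<^sup>+x. \<integral>\<^sup>+y. f (x(i := y)) \<partial>normal_measure \<sigma> \<partial>gaussian I \<sigma>))"
    using insert.IH[OF meas2] by (simp only: \<sigma>_def)
  also have "(\<integral>\<^sup>+x. \<integral>\<^sup>+y. f (x(i := y)) \<partial>normal_measure \<sigma> \<partial>gaussian I \<sigma>) = (\<integral>\<^sup>+x. f x \<partial>gaussian (insert i I) \<sigma>)"
    unfolding gaussian_def by (rule N\<sigma>.product_nn_integral_insert[symmetric, OF _ _ fN]) (use insert.hyps in auto)
  also have "ennreal \<sigma> * (ennreal ((1 + 2 * t) powr (- real (card I) / 2)) * (\<integral>\<^sup>+x. f x \<partial>gaussian (insert i I) \<sigma>))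
    = ennreal ((1 + 2 * t) powr (- real (card (insert i I)) / 2)) * (\<integral>\<^sup>+x. f x \<partial>gaussian (insert i I) \<sigma>)"
    using insert.hyps \<open>t \<ge> 0\<close> by (simp add: \<sigma>_def mult.assoc[symmetric] add_divide_distrib diff_divide_distrib flip: ennreal_mult powr_add)
  finally show ?case unfolding \<sigma>_def .
qed

text \<open>The joint law of the coordinates is the product measure itself, hence the product of its
  marginals. Used both for the coordinates of a Gaussian vector and for the members of a random
  sample.\<close>

lemma indep_vars_PiM_coordinates:
  assumes "\<And>i. i \<in> I \<Longrightarrow> prob_space (M i)" "I \<noteq> {}"
  shows "prob_space.indep_vars (PiM I M) M (\<lambda>i x. x i) I"
proof -
  interpret P: prob_space "PiM I M" by (intro prob_space_PiM assms)
  have "distr (PiM I M) (PiM I M) (\<lambda>x. \<lambda>i\<in>I. x i) = distr (PiM I M) (PiM I M) (\<lambda>x. x)"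
    by (rule distr_cong) (auto simp: space_PiM PiE_restrict)
  also have "\<dots> = PiM I (\<lambda>i. distr (PiM I M) (M i) (\<lambda>x. x i))"
    by (subst distr_id) (rule PiM_cong, auto simp: distr_PiM_component assms)
  finally show ?thesis
    by (subst P.indep_vars_iff_distr_eq_PiM') (use assms in auto)
qed

text \<open>The only form of rotation invariance that the proof needs: a linear functional with unit
  coefficient vector has the law of a single coordinate.\<close>

lemma distributed_gaussian_inner:
  fixes v :: "'i \<Rightarrow> real"
  assumes fin: "finite I" and \<sigma>: "\<sigma> > 0" and v: "(\<Sum>i\<in>I. (v i)\<^sup>2) = 1"
  shows "distributed (gaussian I \<sigma>) lborel (\<lambda>x. \<Sum>i\<in>I. v i * x i) (normal_density 0 \<sigma>)"
proof -
  \<comment> \<open>Sums of independent normal variables are available for positive deviations only,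
    so the coordinates where \<open>v\<close> vanishes are dropped.\<close>
  define J where "J = {i\<in>I. v i \<noteq> 0}"
  have J: "finite J" "J \<subseteq> I" using fin by (auto simp: J_def)
  have sumJ: "(\<Sum>i\<in>J. (v i)\<^sup>2) = 1"
    using v by (subst sum.mono_neutral_left[of I J]) (auto simp: J_def fin)
  then have "J \<noteq> {}" by auto
  have pn: "prob_space (normal_measure \<sigma>)" by (rule prob_space_normal_density[OF \<sigma>])
  interpret prob_space "gaussian I \<sigma>" by (rule prob_space_gaussian[OF \<sigma>])
  have "indep_vars (\<lambda>_. normal_measure \<sigma>) (\<lambda>i x. x i) I"
    unfolding gaussian_def
    by (rule indep_vars_PiM_coordinates) (use pn J \<open>J \<noteq> {}\<close> in auto)
  then have "indep_vars (\<lambda>_. borel) (\<lambda>i x. v i * x i) I"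
    by (rule indep_vars_compose2) measurable
  then have ind: "indep_vars (\<lambda>_. borel) (\<lambda>i x. v i * x i) J"
    by (rule indep_vars_subset) (rule J)
  have coord: "distributed (gaussian I \<sigma>) lborel (\<lambda>x. 0 + v i * x i) (normal_density (0 + v i * 0) (\<bar>v i\<bar> * \<sigma>))"
    if "i \<in> J" for i
  proof (rule normal_density_affine[OF _ \<sigma>])
    have "i \<in> I" using that J by auto
    then have "distr (gaussian I \<sigma>) (normal_measure \<sigma>) (\<lambda>x. x i) = normal_measure \<sigma>"
      unfolding gaussian_def by (intro distr_PiM_component pn)
    moreover have "distr (gaussian I \<sigma>) (normal_measure \<sigma>) (\<lambda>x. x i) = distr (gaussian I \<sigma>) lborel (\<lambda>x. x i)"
      by (rule distr_cong) auto
    moreover have "(\<lambda>x. x i) \<in> measurable (gaussian I \<sigma>) lborel"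
      using \<open>i \<in> I\<close> by measurable
    ultimately show "distributed (gaussian I \<sigma>) lborel (\<lambda>x. x i) (normal_density 0 \<sigma>)"
      by (simp add: distributed_def)
    show "v i \<noteq> 0" using that by (simp add: J_def)
  qed
  have "distributed (gaussian I \<sigma>) lborel (\<lambda>x. \<Sum>i\<in>J. v i * x i)
     (normal_density (\<Sum>i\<in>J. 0) (sqrt (\<Sum>i\<in>J. (\<bar>v i\<bar> * \<sigma>)\<^sup>2)))"
    by (rule sum_indep_normal[OF J(1) \<open>J \<noteq> {}\<close> ind]) (use coord \<sigma> in \<open>auto simp: J_def\<close>)
  moreover have "(\<Sum>i\<in>J. v i * x i) = (\<Sum>i\<in>I. v i * x i)" for x :: "'i \<Rightarrow> real"
    by (rule sum.mono_neutral_left) (auto simp: J_def fin)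
  moreover have "sqrt (\<Sum>i\<in>J. (\<bar>v i\<bar> * \<sigma>)\<^sup>2) = \<sigma>"
    using \<sigma> sumJ by (simp add: power_mult_distrib flip: sum_distrib_right)
  ultimately show ?thesis by simp
qed

text \<open>Kept as an unevaluated extended real: its value, and with it its finiteness, comes out
  in \<open>normal_moment_eq\<close> from the one-dimensional case of the general identity.\<close>

definition normal_moment :: "real \<Rightarrow> ennreal" where
  "normal_moment p = (\<integral>\<^sup>+y. ennreal (\<bar>y\<bar> powr p) \<partial>normal_measure 1)"

lemma nn_integral_normal_powr:
  assumes "\<sigma> > 0"
  shows "(\<integral>\<^sup>+y. ennreal (\<bar>y\<bar> powr p) \<partial>normal_measure \<sigma>) = ennreal (\<sigma> powr p) * normal_moment p"
proof -
  have "(\<integral>\<^sup>+y. ennreal (\<bar>y\<bar> powr p) \<partial>normal_measure \<sigma>)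
      = (\<integral>\<^sup>+y. ennreal (normal_density 0 \<sigma> y) * ennreal (\<bar>y\<bar> powr p) \<partial>lborel)"
    by (subst nn_integral_density) auto
  also have "\<dots> = ennreal \<bar>\<sigma>\<bar> * (\<integral>\<^sup>+y. ennreal (normal_density 0 \<sigma> (0 + \<sigma> * y)) * ennreal (\<bar>0 + \<sigma> * y\<bar> powr p) \<partial>lborel)"
    by (rule nn_integral_real_affine) (use assms in auto)
  also have "\<dots> = (\<integral>\<^sup>+y. ennreal \<bar>\<sigma>\<bar> * (ennreal (normal_density 0 \<sigma> (0 + \<sigma> * y)) * ennreal (\<bar>0 + \<sigma> * y\<bar> powr p)) \<partial>lborel)"
    by (rule nn_integral_cmult[symmetric]) auto
  also have "\<dots> = (\<integral>\<^sup>+y. ennreal (\<sigma> powr p) * (ennreal (normal_density 0 1 y) * ennreal (\<bar>y\<bar> powr p)) \<partial>lborel)"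
  proof (rule nn_integral_cong)
    fix y
    have "\<sigma> * normal_density 0 \<sigma> (\<sigma> * y) = normal_density 0 1 y"
      using assms by (simp add: normal_density_def power_mult_distrib real_sqrt_mult)
    moreover have "\<bar>\<sigma> * y\<bar> powr p = \<sigma> powr p * \<bar>y\<bar> powr p"
      using assms by (simp add: abs_mult powr_mult)
    ultimately have "\<bar>\<sigma>\<bar> * (normal_density 0 \<sigma> (0 + \<sigma> * y) * \<bar>0 + \<sigma> * y\<bar> powr p)
       = \<sigma> powr p * (normal_density 0 1 y * \<bar>y\<bar> powr p)"
      using assms by (simp add: mult.assoc[symmetric])
    then show "ennreal \<bar>\<sigma>\<bar> * (ennreal (normal_density 0 \<sigma> (0 + \<sigma> * y)) * ennreal (\<bar>0 + \<sigma> * y\<bar> powr p))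
       = ennreal (\<sigma> powr p) * (ennreal (normal_density 0 1 y) * ennreal (\<bar>y\<bar> powr p))"
      by (simp flip: ennreal_mult)
  qed
  also have "\<dots> = ennreal (\<sigma> powr p) * (\<integral>\<^sup>+y. ennreal (normal_density 0 1 y) * ennreal (\<bar>y\<bar> powr p) \<partial>lborel)"
    by (rule nn_integral_cmult) auto
  also have "(\<integral>\<^sup>+y. ennreal (normal_density 0 1 y) * ennreal (\<bar>y\<bar> powr p) \<partial>lborel) = normal_moment p"
    unfolding normal_moment_def by (subst nn_integral_density) auto
  finally show ?thesis .
qed

lemma nn_integral_gaussian_inner_powr:
  fixes v :: "'i \<Rightarrow> real"
  assumes "finite I" "\<sigma> > 0" "(\<Sum>i\<in>I. (v i)\<^sup>2) = 1"
  shows "(\<integral>\<^sup>+x. ennreal (\<bar>\<Sum>i\<in>I. v i * x i\<bar> powr p) \<partial>gaussian I \<sigma>) = ennreal (\<sigma> powr p) * normal_moment p"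
proof -
  have "(\<integral>\<^sup>+x. ennreal (\<bar>\<Sum>i\<in>I. v i * x i\<bar> powr p) \<partial>gaussian I \<sigma>)
    = (\<integral>\<^sup>+y. ennreal (normal_density 0 \<sigma> y) * ennreal (\<bar>y\<bar> powr p) \<partial>lborel)"
    by (rule distributed_nn_integral[OF distributed_gaussian_inner[OF assms], symmetric]) auto
  also have "\<dots> = (\<integral>\<^sup>+y. ennreal (\<bar>y\<bar> powr p) \<partial>normal_measure \<sigma>)"
    by (subst nn_integral_density) auto
  finally show ?thesis using nn_integral_normal_powr[OF assms(2)] by simp
qed

text \<open>A single coordinate is already nonzero almost surely, as its law has a density. This
  makes normalisation and negative powers of the norm harmless.\<close>

lemma AE_gaussian_sum_squares_pos:
  fixes I :: "'i set"
  assumes "finite I" "I \<noteq> {}" "\<sigma> > 0"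
  shows "AE x in gaussian I \<sigma>. (\<Sum>i\<in>I. (x i)\<^sup>2) > 0"
proof -
  obtain i where i: "i \<in> I" using assms by auto
  have "AE y in normal_measure \<sigma>. y \<noteq> 0"
    by (subst AE_density) (use AE_lborel_singleton[of "0::real"] in auto)
  then have "AE x in gaussian I \<sigma>. x i \<noteq> 0"
    unfolding gaussian_def by (rule AE_PiM_component[rotated 2]) (use i assms prob_space_normal_density in auto)
  then show ?thesis
  proof eventually_elim
    case (elim x)
    then have "0 < (x i)\<^sup>2" by simp
    also have "\<dots> \<le> (\<Sum>i\<in>I. (x i)\<^sup>2)" by (rule member_le_sum) (use i assms in auto)
    finally show ?case .
  qed
qed

subsection \<open>Moments of a random direction\<close>

text \<open>A beta integral. Write Gamma(a) (1 + 2t)^(-a) as the integral of y^(a-1) exp(-y(1 + 2t))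
  over y > 0 and exchange the integrals: integration over t gives Gamma(s) (2y)^(-s), and the Gamma
  integral for a - s remains.\<close>

lemma nn_integral_beta_prime:
  fixes s a :: real
  assumes "0 < s" "s < a"
  shows "ennreal (Gamma a) * (\<integral>\<^sup>+t. ennreal (indicator {0..} t * t powr (s - 1) * (1 + 2 * t) powr (- a)) \<partial>lborel)
    = ennreal (Gamma s * 2 powr (- s) * Gamma (a - s))"
proof -
  define h where "h b y = indicator {0..} y * y powr (b - 1)" for b y :: real
  have h_nonneg: "h b y \<ge> 0" for b y by (simp add: h_def)
  have [measurable]: "h b \<in> borel_measurable borel" for b unfolding h_def by measurable
  have Gamma_int: "(\<integral>\<^sup>+t. ennreal (h b t * exp (- (t * r))) \<partial>lborel) = ennreal (Gamma b * r powr (- b))"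
    if "b > 0" "r > 0" for b r
    using nn_integral_Gamma_scaled[OF that] by (simp add: h_def)
  have "ennreal (Gamma a) * (\<integral>\<^sup>+t. ennreal (h s t * (1 + 2 * t) powr (- a)) \<partial>lborel)
      = (\<integral>\<^sup>+t. ennreal (Gamma a) * ennreal (h s t * (1 + 2 * t) powr (- a)) \<partial>lborel)"
    by (rule nn_integral_cmult[symmetric]) measurable
  also have "\<dots> = (\<integral>\<^sup>+t. \<integral>\<^sup>+y. ennreal (h s t * (h a y * exp (- (y * (1 + 2 * t))))) \<partial>lborel \<partial>lborel)"
  proof (rule nn_integral_cong)
    fix t :: real
    show "ennreal (Gamma a) * ennreal (h s t * (1 + 2 * t) powr (- a))
      = (\<integral>\<^sup>+y. ennreal (h s t * (h a y * exp (- (y * (1 + 2 * t))))) \<partial>lborel)"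
    proof (cases "t \<ge> 0")
      case True
      have "(\<integral>\<^sup>+y. ennreal (h s t * (h a y * exp (- (y * (1 + 2 * t))))) \<partial>lborel)
        = (\<integral>\<^sup>+y. ennreal (h s t) * ennreal (h a y * exp (- (y * (1 + 2 * t)))) \<partial>lborel)"
        by (simp add: ennreal_mult h_nonneg)
      also have "\<dots> = ennreal (h s t) * (\<integral>\<^sup>+y. ennreal (h a y * exp (- (y * (1 + 2 * t)))) \<partial>lborel)"
        by (rule nn_integral_cmult) measurable
      also have "\<dots> = ennreal (h s t) * ennreal (Gamma a * (1 + 2 * t) powr (- a))"
        by (subst Gamma_int) (use assms True in auto)
      also have "\<dots> = ennreal (Gamma a) * ennreal (h s t * (1 + 2 * t) powr (- a))"
        using assms by (simp add: h_nonneg Gamma_real_nonneg mult_ac flip: ennreal_mult)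
      finally show ?thesis ..
    qed (simp add: h_def)
  qed
  also have "\<dots> = (\<integral>\<^sup>+y. \<integral>\<^sup>+t. ennreal (h s t * (h a y * exp (- (y * (1 + 2 * t))))) \<partial>lborel \<partial>lborel)"
    by (rule lborel_pair.Fubini') measurable
  also have "\<dots> = (\<integral>\<^sup>+y. ennreal (Gamma s * 2 powr (- s)) * ennreal (h (a - s) y * exp (- (y * 1))) \<partial>lborel)"
  proof (rule nn_integral_cong)
    fix y :: real
    show "(\<integral>\<^sup>+t. ennreal (h s t * (h a y * exp (- (y * (1 + 2 * t))))) \<partial>lborel)
      = ennreal (Gamma s * 2 powr (- s)) * ennreal (h (a - s) y * exp (- (y * 1)))"
    proof (cases "y > 0")
      case True
      have eq: "h s t * (h a y * exp (- (y * (1 + 2 * t)))) = (h a y * exp (- y)) * (h s t * exp (- (t * (2 * y))))" for t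
        by (simp add: mult_ac distrib_left exp_add[symmetric])
      have "(\<integral>\<^sup>+t. ennreal (h s t * (h a y * exp (- (y * (1 + 2 * t))))) \<partial>lborel)
        = (\<integral>\<^sup>+t. ennreal (h a y * exp (- y)) * ennreal (h s t * exp (- (t * (2 * y)))) \<partial>lborel)"
        unfolding eq by (simp add: ennreal_mult h_nonneg)
      also have "\<dots> = ennreal (h a y * exp (- y)) * (\<integral>\<^sup>+t. ennreal (h s t * exp (- (t * (2 * y)))) \<partial>lborel)"
        by (rule nn_integral_cmult) measurable
      also have "\<dots> = ennreal (h a y * exp (- y)) * ennreal (Gamma s * (2 * y) powr (- s))"
        by (subst Gamma_int) (use assms True in auto)
      also have "\<dots> = ennreal ((h a y * exp (- y)) * (Gamma s * (2 * y) powr (- s)))"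
        using assms by (simp add: h_nonneg Gamma_real_nonneg ennreal_mult)
      also have "(h a y * exp (- y)) * (Gamma s * (2 * y) powr (- s)) = (Gamma s * 2 powr (- s)) * ((y powr (a - 1) * y powr (- s)) * exp (- y))"
        using True by (simp add: h_def powr_mult mult_ac)
      also have "y powr (a - 1) * y powr (- s) = h (a - s) y"
        using True by (simp add: h_def powr_add[symmetric] algebra_simps)
      finally show ?thesis
        using assms by (simp add: h_nonneg Gamma_real_nonneg ennreal_mult)
    next
      case False
      then have "h a y = 0" "h (a - s) y = 0" by (auto simp: h_def indicator_def)
      then show ?thesis by simp
    qed
  qed
  also have "\<dots> = ennreal (Gamma s * 2 powr (- s)) * (\<integral>\<^sup>+y. ennreal (h (a - s) y * exp (- (y * 1))) \<partial>lborel)"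
    by (rule nn_integral_cmult) measurable
  also have "\<dots> = ennreal (Gamma s * 2 powr (- s) * Gamma (a - s))"
    by (subst Gamma_int) (use assms in \<open>auto simp: ennreal_mult Gamma_real_nonneg\<close>)
  finally show ?thesis by (simp add: h_def)
qed

text \<open>With s = p/2, Gamma(s) |x|^(-p) is the integral of t^(s-1) exp(-t|x|^2). After
  exchanging the integrals, the one over x is a tilted Gaussian moment and the one over t is
  \<open>nn_integral_beta_prime\<close>. The product form makes sense before
  \<open>normal_moment p\<close> is known to be finite.\<close>

lemma nn_integral_gaussian_direction_normal_moment:
  fixes v :: "'i \<Rightarrow> real"
  assumes p: "p > 0" and I: "finite I" "I \<noteq> {}" and v: "(\<Sum>i\<in>I. (v i)\<^sup>2) = 1"
  shows "ennreal (Gamma ((real (card I) + p) / 2)) *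
      (\<integral>\<^sup>+x. ennreal (\<bar>\<Sum>i\<in>I. v i * x i\<bar> powr p * (\<Sum>i\<in>I. (x i)\<^sup>2) powr (- p / 2)) \<partial>gaussian I 1)
    = normal_moment p * ennreal (2 powr (- p / 2) * Gamma (real (card I) / 2))"
proof -
  define s where "s = p / 2"
  define a where "a = (real (card I) + p) / 2"
  define F where "F x = \<bar>\<Sum>i\<in>I. v i * x i\<bar> powr p" for x
  define S where "S x = (\<Sum>i\<in>I. (x i)\<^sup>2)" for x :: "'i \<Rightarrow> real"
  define h where "h t = indicator {0..} t * t powr (s - 1)" for t :: real
  have card: "card I > 0" using I by (simp add: card_gt_0_iff)
  have s: "s > 0" "s < a" "a - s = real (card I) / 2" using p card by (auto simp: s_def a_def field_simps)
  have Gs: "Gamma s > 0" using s by (simp add: Gamma_real_pos)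
  have h_nonneg: "h t \<ge> 0" for t by (simp add: h_def)
  have F_nonneg: "F x \<ge> 0" for x by (simp add: F_def)
  have [measurable]: "h \<in> borel_measurable borel" unfolding h_def by measurable
  have Fb: "F \<in> borel_measurable (PiM I (\<lambda>_. borel))" unfolding F_def by measurable
  have [measurable]: "F \<in> borel_measurable (gaussian I 1)" "S \<in> borel_measurable (gaussian I 1)"
    unfolding F_def S_def by measurable
  interpret G: prob_space "gaussian I 1" by (rule prob_space_gaussian) simp
  interpret P: pair_sigma_finite "gaussian I 1" lborel ..
  \<comment> \<open>The exponent \<open>a\<close> collects \<open>card I / 2\<close> from the mass
    of the tilted measure and \<open>p / 2\<close> from the scaling of the moment.\<close>
  have tilt: "(\<integral>\<^sup>+x. ennreal (F x) * ennreal (exp (- (t * S x))) \<partial>gaussian I 1) = normal_moment p * ennreal ((1 + 2 * t) powr (- a))"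
    if "t \<ge> 0" for t
  proof -
    have "(\<integral>\<^sup>+x. ennreal (F x) * ennreal (exp (- (t * S x))) \<partial>gaussian I 1)
      = ennreal ((1 + 2 * t) powr (- real (card I) / 2)) * (\<integral>\<^sup>+x. ennreal (F x) \<partial>gaussian I ((1 + 2 * t) powr (- 1/2)))"
      unfolding S_def by (rule nn_integral_gaussian_tilt) (use I that Fb in auto)
    also have "(\<integral>\<^sup>+x. ennreal (F x) \<partial>gaussian I ((1 + 2 * t) powr (- 1/2)))
      = ennreal (((1 + 2 * t) powr (- 1/2)) powr p) * normal_moment p"
      unfolding F_def by (rule nn_integral_gaussian_inner_powr) (use I that v in auto)
    also have "((1 + 2 * t) powr (- 1/2)) powr p = (1 + 2 * t) powr (- p / 2)"
      by (simp add: powr_powr)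
    also have "ennreal ((1 + 2 * t) powr (- real (card I) / 2)) * (ennreal ((1 + 2 * t) powr (- p / 2)) * normal_moment p)
       = normal_moment p * ennreal ((1 + 2 * t) powr (- real (card I) / 2) * (1 + 2 * t) powr (- p / 2))"
      by (simp add: ennreal_mult mult_ac)
    also have "(1 + 2 * t) powr (- real (card I) / 2) * (1 + 2 * t) powr (- p / 2) = (1 + 2 * t) powr (- a)"
      by (simp add: a_def powr_add[symmetric] add_divide_distrib)
    finally show ?thesis .
  qed
  have "ennreal (Gamma s) * (\<integral>\<^sup>+x. ennreal (F x * S x powr (- s)) \<partial>gaussian I 1)
      = (\<integral>\<^sup>+x. ennreal (Gamma s) * ennreal (F x * S x powr (- s)) \<partial>gaussian I 1)"
    by (rule nn_integral_cmult[symmetric]) measurable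
  also have "\<dots> = (\<integral>\<^sup>+x. \<integral>\<^sup>+t. ennreal (F x) * ennreal (h t * exp (- (t * S x))) \<partial>lborel \<partial>gaussian I 1)"
  \<comment> \<open>The Gamma integral requires \<open>S x > 0\<close>, so the integrands are
    compared almost everywhere only.\<close>
  proof (rule nn_integral_cong_AE)
    show "AE x in gaussian I 1. ennreal (Gamma s) * ennreal (F x * S x powr (- s))
       = (\<integral>\<^sup>+t. ennreal (F x) * ennreal (h t * exp (- (t * S x))) \<partial>lborel)"
      using AE_gaussian_sum_squares_pos[OF I zero_less_one]
    proof eventually_elim
      case (elim x)
      have "(\<integral>\<^sup>+t. ennreal (F x) * ennreal (h t * exp (- (t * S x))) \<partial>lborel)
         = ennreal (F x) * (\<integral>\<^sup>+t. ennreal (h t * exp (- (t * S x))) \<partial>lborel)"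
        by (rule nn_integral_cmult) measurable
      also have "(\<integral>\<^sup>+t. ennreal (h t * exp (- (t * S x))) \<partial>lborel) = ennreal (Gamma s * S x powr (- s))"
        unfolding h_def by (rule nn_integral_Gamma_scaled) (use elim s in \<open>auto simp: S_def\<close>)
      finally show ?case using Gs
        by (simp add: F_nonneg ennreal_mult mult_ac)
    qed
  qed
  also have "\<dots> = (\<integral>\<^sup>+t. \<integral>\<^sup>+x. ennreal (F x) * ennreal (h t * exp (- (t * S x))) \<partial>gaussian I 1 \<partial>lborel)"
    by (rule P.Fubini'[symmetric]) measurable
  also have "\<dots> = (\<integral>\<^sup>+t. normal_moment p * ennreal (h t * (1 + 2 * t) powr (- a)) \<partial>lborel)"
  proof (rule nn_integral_cong)
    fix t :: real
    have "(\<integral>\<^sup>+x. ennreal (F x) * ennreal (h t * exp (- (t * S x))) \<partial>gaussian I 1)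
      = (\<integral>\<^sup>+x. ennreal (h t) * (ennreal (F x) * ennreal (exp (- (t * S x)))) \<partial>gaussian I 1)"
      by (simp only: ennreal_mult h_nonneg F_nonneg exp_ge_zero mult_ac)
    also have "\<dots> = ennreal (h t) * (\<integral>\<^sup>+x. ennreal (F x) * ennreal (exp (- (t * S x))) \<partial>gaussian I 1)"
      by (rule nn_integral_cmult) measurable
    also have "\<dots> = normal_moment p * ennreal (h t * (1 + 2 * t) powr (- a))"
    proof (cases "t \<ge> 0")
      case True
      show ?thesis unfolding tilt[OF True] by (simp add: ennreal_mult h_nonneg mult_ac)
    qed (simp add: h_def)
    finally show "(\<integral>\<^sup>+x. ennreal (F x) * ennreal (h t * exp (- (t * S x))) \<partial>gaussian I 1) = \<dots>" .
  qed
  also have "\<dots> = normal_moment p * (\<integral>\<^sup>+t. ennreal (h t * (1 + 2 * t) powr (- a)) \<partial>lborel)"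
    by (rule nn_integral_cmult) measurable
  finally have eq: "ennreal (Gamma s) * (\<integral>\<^sup>+x. ennreal (F x * S x powr (- s)) \<partial>gaussian I 1) =
     normal_moment p * (\<integral>\<^sup>+t. ennreal (h t * (1 + 2 * t) powr (- a)) \<partial>lborel)" (is "_ * ?J = _ * ?B") .
  have "ennreal (Gamma s) * (ennreal (Gamma a) * ?J) = normal_moment p * (ennreal (Gamma a) * ?B)"
    by (subst mult.left_commute, subst eq, subst mult.left_commute, rule refl)
  also have "ennreal (Gamma a) * ?B = ennreal (Gamma s * 2 powr (- s) * Gamma (a - s))"
    unfolding h_def by (rule nn_integral_beta_prime) (use s in auto)
  also have "\<dots> = ennreal (Gamma s) * ennreal (2 powr (- s) * Gamma (a - s))"
    using Gs by (simp add: ennreal_mult' mult.assoc)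
  finally have "ennreal (Gamma s) * (ennreal (Gamma a) * ?J) = ennreal (Gamma s) * (normal_moment p * ennreal (2 powr (- s) * Gamma (a - s)))"
    by (simp add: mult_ac)
  \<comment> \<open>The auxiliary factor \<open>Gamma s\<close> from the integral representation
    cancels, being positive and finite.\<close>
  then have "ennreal (Gamma a) * ?J = normal_moment p * ennreal (2 powr (- s) * Gamma (a - s))"
    using Gs by (subst (asm) ennreal_mult_cancel_left) auto
  then show ?thesis unfolding s(3) by (simp add: a_def s_def F_def S_def)
qed

text \<open>In dimension one the integrand |x|^p |x|^(-p) is 1 almost surely, so the preceding
  identity can be solved for the moment, with Gamma(1/2) = sqrt(pi).\<close>

lemma normal_moment_eq:
  assumes "p > 0"
  shows "normal_moment p = ennreal (2 powr (p / 2) * Gamma ((p + 1) / 2) / sqrt pi)"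
proof -
  interpret G: prob_space "gaussian {0::nat} 1" by (rule prob_space_gaussian) simp
  have "(\<integral>\<^sup>+x. ennreal (\<bar>\<Sum>i\<in>{0}. 1 * x i\<bar> powr p * (\<Sum>i\<in>{0}. (x i)\<^sup>2) powr (- p / 2)) \<partial>gaussian {0::nat} 1)
     = (\<integral>\<^sup>+x. 1 \<partial>gaussian {0::nat} 1)"
  proof (rule nn_integral_cong_AE)
    show "AE x in gaussian {0::nat} 1. ennreal (\<bar>\<Sum>i\<in>{0}. 1 * x i\<bar> powr p * (\<Sum>i\<in>{0}. (x i)\<^sup>2) powr (- p / 2)) = 1"
      using AE_gaussian_sum_squares_pos[of "{0::nat}" 1, simplified]
    proof eventually_elim
      case (elim x)
      have "(x 0)\<^sup>2 powr (- p / 2) = (\<bar>x 0\<bar> powr 2) powr (- p / 2)" using elim by simp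
      also have "\<dots> = \<bar>x 0\<bar> powr (- p)" by (simp only: powr_powr) simp
      finally show ?case using elim by (simp add: powr_minus)
    qed
  qed
  also have "\<dots> = 1" by (simp add: G.emeasure_space_1)
  finally have "normal_moment p * ennreal (2 powr (- p / 2) * sqrt pi) = ennreal (Gamma ((1 + p) / 2))"
    using nn_integral_gaussian_direction_normal_moment[of p "{0::nat}" "\<lambda>_. 1"] assms
    by (simp add: Gamma_one_half_real)
  then have "normal_moment p * (ennreal (2 powr (- p / 2) * sqrt pi) * ennreal (2 powr (p / 2) / sqrt pi))
     = ennreal (Gamma ((1 + p) / 2)) * ennreal (2 powr (p / 2) / sqrt pi)"
    by (simp only: mult.assoc[symmetric])
  also have "ennreal (2 powr (- p / 2) * sqrt pi) * ennreal (2 powr (p / 2) / sqrt pi) = 1"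
    by (simp add: powr_minus flip: ennreal_mult)
  finally have "normal_moment p = ennreal (Gamma ((1 + p) / 2)) * ennreal (2 powr (p / 2) / sqrt pi)"
    by simp
  also have "\<dots> = ennreal (Gamma ((1 + p) / 2) * (2 powr (p / 2) / sqrt pi))"
    using assms by (intro ennreal_mult[symmetric]) (auto simp: Gamma_real_nonneg)
  finally show ?thesis by (simp add: add.commute mult.commute)
qed

text \<open>Inserting the one-dimensional moment cancels the powers of 2, and the quotient of Gamma
  values that remains is \<open>mu d p\<close>.\<close>

theorem nn_integral_gaussian_direction_powr:
  fixes v :: "nat \<Rightarrow> real"
  assumes p: "p > 0" and d: "d > 0" and v: "(\<Sum>i<d. (v i)\<^sup>2) = 1"
  shows "(\<integral>\<^sup>+x. ennreal (\<bar>\<Sum>i<d. v i * x i\<bar> powr p * (\<Sum>i<d. (x i)\<^sup>2) powr (- p / 2)) \<partial>gaussian {..<d} 1)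
    = ennreal (mu d p)" (is "?J = _")
proof -
  define g where "g = Gamma ((real d + p) / 2)"
  have g: "g > 0" using p by (simp add: g_def Gamma_real_pos)
  have "ennreal g * ?J = normal_moment p * ennreal (2 powr (- p / 2) * Gamma (real d / 2))"
    unfolding g_def using nn_integral_gaussian_direction_normal_moment[OF p, of "{..<d}" v] d v by auto
  also have "\<dots> = ennreal (2 powr (p / 2) * Gamma ((p + 1) / 2) / sqrt pi * (2 powr (- p / 2) * Gamma (real d / 2)))"
    unfolding normal_moment_eq[OF p] using p d by (intro ennreal_mult[symmetric]) (auto simp: Gamma_real_nonneg)
  also have "2 powr (p / 2) * Gamma ((p + 1) / 2) / sqrt pi * (2 powr (- p / 2) * Gamma (real d / 2)) = g * mu d p"
    using g by (simp add: mu_def g_def powr_minus field_simps)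
  also have "ennreal (g * mu d p) = ennreal g * ennreal (mu d p)"
    using g by (simp add: ennreal_mult')
  finally show ?thesis using g by (subst (asm) ennreal_mult_cancel_left) auto
qed

subsection \<open>Averaging and random configurations\<close>

text \<open>The vector x/|x|, with a fixed basis vector as value where the norm vanishes, so that
  for \<open>d > 0\<close> every value lies on the sphere. Coordinates from \<open>d\<close> on are
  set to 0, whereas points of the product space are \<open>undefined\<close> there.\<close>

definition direction :: "nat \<Rightarrow> (nat \<Rightarrow> real) \<Rightarrow> nat \<Rightarrow> real" where
  "direction d x = (if 0 < (\<Sum>i<d. (x i)\<^sup>2) then (\<lambda>i. if i < d then x i / sqrt (\<Sum>i<d. (x i)\<^sup>2) else 0)
     else (\<lambda>i. if i = 0 then 1 else 0))"

lemma direction_in_unit_sphere: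
  assumes "d > 0"
  shows "direction d x \<in> unit_sphere d"
proof (cases "0 < (\<Sum>i<d. (x i)\<^sup>2)")
  case True
  have "(\<Sum>i<d. (direction d x i)\<^sup>2) = (\<Sum>i<d. (x i)\<^sup>2 / (\<Sum>i<d. (x i)\<^sup>2))"
    using True by (intro sum.cong) (auto simp: direction_def power_divide)
  also have "\<dots> = 1" using True by (simp flip: sum_divide_distrib)
  finally show ?thesis using True
    by (auto simp: unit_sphere_def topspace_Euclidean_space direction_def)
next
  case False
  have "(\<Sum>i<d. (if i = 0 then 1 else 0 :: real)\<^sup>2) = (\<Sum>i<d. if i = 0 then 1 else 0)"
    by (intro sum.cong) auto
  also have "\<dots> = 1" using assms by simp
  finally show ?thesis using False assms
    by (auto simp: unit_sphere_def topspace_Euclidean_space direction_def)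
qed

lemma dot_direction:
  assumes "0 < (\<Sum>i<d. (x i)\<^sup>2)"
  shows "dot d v (direction d x) = (\<Sum>i<d. v i * x i) / sqrt (\<Sum>i<d. (x i)\<^sup>2)"
  using assms by (simp add: dot_def direction_def sum_divide_distrib)

lemma measurable_dot_direction [measurable]:
  "(\<lambda>x. dot d v (direction d x)) \<in> borel_measurable (gaussian {..<d} 1)"
proof -
  have "(\<lambda>x. dot d v (direction d x)) = (\<lambda>x. if 0 < (\<Sum>i<d. (x i)\<^sup>2)
      then (\<Sum>i<d. v i * x i) / sqrt (\<Sum>i<d. (x i)\<^sup>2) else dot d v (\<lambda>i. if i = 0 then 1 else 0))"
    by (rule ext) (simp add: dot_direction, simp add: direction_def)
  also have "\<dots> \<in> borel_measurable (gaussian {..<d} 1)" by measurable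
  finally show ?thesis .
qed

text \<open>The mean of one summand of the potential, the same for every unit vector
  \<open>v\<close>; the default value of \<open>direction\<close> occurs on a null set only.\<close>

lemma nn_integral_dot_direction_powr:
  assumes p: "p > 0" and d: "d > 0" and v: "v \<in> unit_sphere d"
  shows "(\<integral>\<^sup>+x. ennreal (\<bar>dot d v (direction d x)\<bar> powr p) \<partial>gaussian {..<d} 1) = ennreal (mu d p)"
proof -
  have "(\<integral>\<^sup>+x. ennreal (\<bar>dot d v (direction d x)\<bar> powr p) \<partial>gaussian {..<d} 1)
    = (\<integral>\<^sup>+x. ennreal (\<bar>\<Sum>i<d. v i * x i\<bar> powr p * (\<Sum>i<d. (x i)\<^sup>2) powr (- p / 2)) \<partial>gaussian {..<d} 1)"
  proof (rule nn_integral_cong_AE)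
    have "AE x in gaussian {..<d} 1. (\<Sum>i<d. (x i)\<^sup>2) > 0"
      by (rule AE_gaussian_sum_squares_pos) (use d in auto)
    then show "AE x in gaussian {..<d} 1. ennreal (\<bar>dot d v (direction d x)\<bar> powr p)
      = ennreal (\<bar>\<Sum>i<d. v i * x i\<bar> powr p * (\<Sum>i<d. (x i)\<^sup>2) powr (- p / 2))"
    proof eventually_elim
      case (elim x)
      define S where "S = (\<Sum>i<d. (x i)\<^sup>2)"
      have S: "S > 0" using elim by (simp add: S_def)
      have "\<bar>dot d v (direction d x)\<bar> powr p = \<bar>\<Sum>i<d. v i * x i\<bar> powr p / sqrt S powr p"
        using S dot_direction[OF elim, of v] by (simp add: powr_divide abs_divide flip: S_def)
      also have "sqrt S powr p = S powr (p / 2)"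
        using S by (simp add: powr_half_sqrt[symmetric] powr_powr)
      finally show ?case by (simp add: powr_minus_divide flip: S_def)
    qed
  qed
  also have "\<dots> = ennreal (mu d p)"
    by (rule nn_integral_gaussian_direction_powr) (use assms in \<open>auto simp: unit_sphere_def\<close>)
  finally show ?thesis .
qed

section \<open>Inner products, extremal potentials and random samples\<close>

lemma dot_commute: "dot d v u = dot d u v"
  by (simp add: dot_def mult.commute)

lemma abs_dot_le_1:
  assumes "u \<in> unit_sphere d" "v \<in> unit_sphere d"
  shows "\<bar>dot d u v\<bar> \<le> 1"
proof -
  have "(dot d u v)\<^sup>2 \<le> (\<Sum>i<d. (u i)\<^sup>2) * (\<Sum>i<d. (v i)\<^sup>2)"
    unfolding dot_def by (rule Cauchy_Schwarz_ineq_sum)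
  also have "\<dots> = 1" using assms by (simp add: unit_sphere_def)
  finally show ?thesis by (simp add: abs_square_le_1)
qed

lemma lp_potential_le_polarization:
  assumes "p > 0" "d > 0" "v \<in> unit_sphere d"
  shows "lp_potential p d n u v \<le> lp_polarization p d n u"
  using lp_polarization_attained[OF assms(1,2), of n u] assms(3) by auto

lemma lp_polarization_le_iff:
  assumes "p > 0" "d > 0"
  shows "lp_polarization p d n u \<le> a \<longleftrightarrow> (\<forall>v\<in>unit_sphere d. lp_potential p d n u v \<le> a)"
  using lp_polarization_attained[OF assms, of n u] by auto

lemma polarization_const_le:
  assumes "p > 0" "d > 0" "\<And>i. i < n \<Longrightarrow> u i \<in> unit_sphere d"
    "\<And>v. v \<in> unit_sphere d \<Longrightarrow> lp_potential p d n u v \<le> a"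
  shows "polarization_const p d n \<le> a"
proof -
  obtain w where w: "polarization_const p d n = lp_polarization p d n w"
    "\<forall>w'\<in>{..<n} \<rightarrow>\<^sub>E unit_sphere d. lp_polarization p d n w \<le> lp_polarization p d n w'"
    using polarization_const_attained[OF assms(1,2), of n] by blast
  \<comment> \<open>The infimum ranges over extensional enumerations; the potential depends only on
    the indices below \<open>n\<close>.\<close>
  have "restrict u {..<n} \<in> {..<n} \<rightarrow>\<^sub>E unit_sphere d" using assms(3) by auto
  then have "polarization_const p d n \<le> lp_polarization p d n (restrict u {..<n})"
    using w by simp
  also have "\<dots> \<le> a"
    unfolding lp_polarization_le_iff[OF assms(1,2)] using assms(4) by (simp add: lp_potential_def)
  finally show ?thesis .
qed

text \<open>The maximum of the potential of an optimal configuration dominates its mean over a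
  random direction. Here the points \<open>u i\<close> are fixed and the argument is random, hence
  the use of \<open>dot_commute\<close>.\<close>

theorem polarization_const_ge:
  assumes p: "p > 0" and d: "d > 0"
  shows "real n * mu d p \<le> polarization_const p d n"
proof -
  interpret G: prob_space "gaussian {..<d} 1" by (rule prob_space_gaussian) simp
  obtain u where u: "u \<in> {..<n} \<rightarrow>\<^sub>E unit_sphere d" "polarization_const p d n = lp_polarization p d n u"
    using polarization_const_attained[OF p d, of n] by blast
  define M where "M = lp_polarization p d n u"
  have le: "lp_potential p d n u (direction d x) \<le> M" for x
    unfolding M_def by (intro lp_potential_le_polarization p d direction_in_unit_sphere)
  have "M \<ge> 0"
    using le[of undefined] by (rule order_trans[rotated]) (simp add: lp_potential_def sum_nonneg)
  have mu: "mu d p \<ge> 0" using p d by (simp add: mu_def Gamma_real_nonneg)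
  have "ennreal (real n * mu d p) = (\<Sum>i<n. ennreal (mu d p))"
    using mu by (simp add: ennreal_mult ennreal_of_nat_eq_real_of_nat)
  also have "\<dots> = (\<Sum>i<n. \<integral>\<^sup>+x. ennreal (\<bar>dot d (u i) (direction d x)\<bar> powr p) \<partial>gaussian {..<d} 1)"
    using u by (intro sum.cong refl nn_integral_dot_direction_powr[symmetric] p d) auto
  also have "\<dots> = (\<integral>\<^sup>+x. (\<Sum>i<n. ennreal (\<bar>dot d (u i) (direction d x)\<bar> powr p)) \<partial>gaussian {..<d} 1)"
    by (rule nn_integral_sum[symmetric]) measurable
  also have "\<dots> \<le> (\<integral>\<^sup>+x. ennreal M \<partial>gaussian {..<d} 1)"
    using le by (intro nn_integral_mono) (simp add: lp_potential_def dot_commute[of d "direction d _"] sum_nonneg ennreal_leI)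
  also have "\<dots> = ennreal M" by (simp add: G.emeasure_space_1)
  finally show ?thesis using \<open>M \<ge> 0\<close> by (simp add: u(2) M_def)
qed

text \<open>Union bound: for each \<open>v\<close> in \<open>T\<close> the summands are independent,
  lie in [0,1] and have mean \<open>mu d p\<close>, so Hoeffding's inequality bounds the failure
  probability. By \<open>small\<close> these probabilities sum to less than 1, and some sample
  succeeds for all of \<open>T\<close>.\<close>

lemma exists_points_small_potential:
  assumes p: "p > 0" and d: "d > 0" and n: "n > 0" and \<epsilon>: "\<epsilon> > 0"
    and T: "finite T" "T \<subseteq> unit_sphere d"
    and small: "real (card T) * exp (- 2 * real n * \<epsilon>\<^sup>2) < 1"
  shows "\<exists>u. (\<forall>i. u i \<in> unit_sphere d) \<and> (\<forall>v\<in>T. lp_potential p d n u v \<le> real n * (mu d p + \<epsilon>))"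
proof -
  define G where "G = gaussian {..<d} 1"
  \<comment> \<open>A sample consists of \<open>n\<close> independent Gaussian vectors; their
    directions form the configuration.\<close>
  define \<Omega> where "\<Omega> = PiM {..<n} (\<lambda>_. G)"
  define X where "X v x = \<bar>dot d v (direction d x)\<bar> powr p" for v x
  interpret G: prob_space G unfolding G_def by (rule prob_space_gaussian) simp
  interpret O: prob_space \<Omega> unfolding \<Omega>_def by (intro prob_space_PiM G.prob_space_axioms)
  have Xm [measurable]: "X v \<in> borel_measurable G" for v unfolding X_def G_def by measurable
  have X_bound: "0 \<le> X v x \<and> X v x \<le> 1" if "v \<in> unit_sphere d" for v x
    using abs_dot_le_1[OF that direction_in_unit_sphere[OF d]] p by (auto simp: X_def intro: powr_le1)
  \<comment> \<open>The bad event at \<open>v\<close>: the potential exceeds its mean by at least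
    \<open>n * \<epsilon>\<close>.\<close>
  define B where "B v = {\<omega>\<in>space \<Omega>. (\<Sum>i<n. X v (\<omega> i)) \<ge> real n * mu d p + real n * \<epsilon>}" for v
  have B: "B v \<in> O.events \<and> O.prob (B v) \<le> exp (- 2 * real n * \<epsilon>\<^sup>2)" if v: "v \<in> unit_sphere d" for v
  proof -
    have "O.indep_vars (\<lambda>_. G) (\<lambda>i \<omega>. \<omega> i) {..<n}"
      unfolding \<Omega>_def by (rule indep_vars_PiM_coordinates) (use n G.prob_space_axioms in auto)
    then have ind: "O.indep_vars (\<lambda>_. borel) (\<lambda>i \<omega>. X v (\<omega> i)) {..<n}"
      by (rule O.indep_vars_compose2) measurable
    have ex: "O.expectation (\<lambda>\<omega>. X v (\<omega> i)) = mu d p" if "i < n" for i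
    proof -
      have "O.expectation (\<lambda>\<omega>. X v (\<omega> i)) = (\<integral>x. X v x \<partial>distr \<Omega> G (\<lambda>\<omega>. \<omega> i))"
        by (rule integral_distr[symmetric]) (use that in \<open>auto simp: \<Omega>_def\<close>)
      also have "distr \<Omega> G (\<lambda>\<omega>. \<omega> i) = G"
        unfolding \<Omega>_def using that by (intro distr_PiM_component G.prob_space_axioms) auto
      also have "(\<integral>x. X v x \<partial>G) = enn2real (\<integral>\<^sup>+x. ennreal (X v x) \<partial>G)"
        by (rule integral_eq_nn_integral) (auto simp: X_def G_def)
      also have "\<dots> = mu d p"
        unfolding X_def G_def nn_integral_dot_direction_powr[OF p d v]
        using p d by (simp add: mu_def Gamma_real_nonneg)
      finally show ?thesis .
    qed
    interpret H: Hoeffding_ineq \<Omega> "{..<n}" "\<lambda>i \<omega>. X v (\<omega> i)" "\<lambda>_. 0" "\<lambda>_. 1" "\<Sum>i<n. O.expectation (\<lambda>\<omega>. X v (\<omega> i))"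
      by unfold_locales (use ind X_bound[OF v] in auto)
    have "O.prob (B v) \<le> exp (- 2 * (real n * \<epsilon>)\<^sup>2 / (\<Sum>i<n. (1 - 0)\<^sup>2))"
      using H.Hoeffding_ineq_ge[of "real n * \<epsilon>"] n \<epsilon> by (simp add: B_def ex)
    also have "- 2 * (real n * \<epsilon>)\<^sup>2 / (\<Sum>i<n. (1 - 0)\<^sup>2) = - 2 * real n * \<epsilon>\<^sup>2"
      using n by (simp add: power2_eq_square)
    moreover have "B v \<in> O.events" unfolding B_def \<Omega>_def by measurable
    ultimately show ?thesis by simp
  qed
  have "O.prob (\<Union>v\<in>T. B v) \<le> (\<Sum>v\<in>T. O.prob (B v))"
    using T B by (intro O.finite_measure_subadditive_finite) auto
  also have "\<dots> \<le> (\<Sum>v\<in>T. exp (- 2 * real n * \<epsilon>\<^sup>2))"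
    using T B by (intro sum_mono) auto
  also have "\<dots> < 1" using small by simp
  finally have "O.prob (\<Union>v\<in>T. B v) \<noteq> O.prob (space \<Omega>)" by (simp add: O.prob_space)
  then have "(\<Union>v\<in>T. B v) \<noteq> space \<Omega>" by auto
  moreover have "(\<Union>v\<in>T. B v) \<subseteq> space \<Omega>" by (auto simp: B_def)
  ultimately have "\<not> space \<Omega> \<subseteq> (\<Union>v\<in>T. B v)" by (simp add: set_eq_subset)
  then obtain \<omega> where \<omega>: "\<omega> \<in> space \<Omega>" "\<omega> \<notin> (\<Union>v\<in>T. B v)" by (meson subsetI)
  have "lp_potential p d n (\<lambda>i. direction d (\<omega> i)) v \<le> real n * (mu d p + \<epsilon>)" if "v \<in> T" for v
    using \<omega> that by (auto simp: B_def X_def lp_potential_def algebra_simps)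
  then show ?thesis
    by (intro exI[of _ "\<lambda>i. direction d (\<omega> i)"]) (auto intro: direction_in_unit_sphere[OF d])
qed

section \<open>Nets on the sphere and continuity of the potential\<close>

lemma unit_sphere_net:
  assumes d: "d > 0" and m: "m > (0::nat)"
  shows "\<exists>T. finite T \<and> T \<subseteq> unit_sphere d \<and> card T \<le> (2 * m + 1) ^ d \<and>
    (\<forall>v\<in>unit_sphere d. \<exists>t\<in>T. \<forall>i<d. \<bar>v i - t i\<bar> \<le> 1 / real m)"
proof -
  \<comment> \<open>\<open>c v\<close> names the grid cell of side \<open>1 / m\<close> that
    contains \<open>v\<close>, and \<open>T\<close> picks one point of the sphere from each cell
    that meets it. So the net lies on the sphere and has at most as many points as there are
    cells.\<close>
  define c where "c v = (\<lambda>i\<in>{..<d}. \<lfloor>real m * v i\<rfloor>)" for v :: "nat \<Rightarrow> real"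
  define T where "T = inv_into (unit_sphere d) c ` c ` unit_sphere d"
  have abs_le: "\<bar>v i\<bar> \<le> 1" if "v \<in> unit_sphere d" "i < d" for v i
  proof -
    have "(v i)\<^sup>2 \<le> (\<Sum>i<d. (v i)\<^sup>2)" using that by (intro member_le_sum) auto
    then show ?thesis using that by (simp add: unit_sphere_def abs_square_le_1)
  qed
  have "c v \<in> {..<d} \<rightarrow>\<^sub>E {- int m..int m}" if "v \<in> unit_sphere d" for v
  proof -
    have "- int m \<le> \<lfloor>real m * v i\<rfloor> \<and> \<lfloor>real m * v i\<rfloor> \<le> int m" if "i < d" for i
    proof -
      have "real m * \<bar>v i\<bar> \<le> real m * 1"
        by (rule mult_left_mono) (use abs_le[OF \<open>v \<in> unit_sphere d\<close> that] in auto)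
      then have "\<bar>real m * v i\<bar> \<le> real m" by (simp add: abs_mult)
      then show ?thesis by linarith
    qed
    then show ?thesis by (auto simp: c_def)
  qed
  then have sub: "c ` unit_sphere d \<subseteq> {..<d} \<rightarrow>\<^sub>E {- int m..int m}" by blast
  have fin: "finite ({..<d} \<rightarrow>\<^sub>E {- int m..int m})" by (intro finite_PiE) auto
  have "card (c ` unit_sphere d) \<le> card ({..<d} \<rightarrow>\<^sub>E {- int m..int m})"
    by (rule card_mono[OF fin sub])
  also have "\<dots> = (2 * m + 1) ^ d" by (simp add: card_PiE nat_add_distrib nat_mult_distrib)
  finally have card: "card (c ` unit_sphere d) \<le> (2 * m + 1) ^ d" .
  have finc: "finite (c ` unit_sphere d)" using sub fin by (rule finite_subset)
  show ?thesis
  proof (intro exI[of _ T] conjI ballI)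
    show "finite T" using finc by (simp add: T_def)
    show "T \<subseteq> unit_sphere d" by (auto simp: T_def intro: inv_into_into)
    show "card T \<le> (2 * m + 1) ^ d" unfolding T_def using card_image_le[OF finc] card by (rule order_trans)
    fix v assume v: "v \<in> unit_sphere d"
    define t where "t = inv_into (unit_sphere d) c (c v)"
    have "t \<in> T" using v by (auto simp: t_def T_def)
    moreover have "\<bar>v i - t i\<bar> \<le> 1 / real m" if "i < d" for i
    proof -
      have "c t = c v" using v by (simp add: t_def f_inv_into_f)
      then have "\<lfloor>real m * t i\<rfloor> = \<lfloor>real m * v i\<rfloor>" using that by (auto simp: c_def fun_eq_iff restrict_def split: if_splits)
      then have "\<bar>real m * v i - real m * t i\<bar> \<le> 1" by linarith
      then have "real m * \<bar>v i - t i\<bar> \<le> 1" by (simp add: abs_mult flip: right_diff_distrib)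
      then show ?thesis using m by (simp add: field_simps)
    qed
    ultimately show "\<exists>t\<in>T. \<forall>i<d. \<bar>v i - t i\<bar> \<le> 1 / real m" by blast
  qed
qed

text \<open>Bernoulli's inequality for real exponents, from the weighted mean inequality for z^p and
  1 with weights 1/p and 1 - 1/p.\<close>

lemma powr_tangent_le:
  fixes z p :: real
  assumes "1 \<le> p" "0 \<le> z"
  shows "1 + p * (z - 1) \<le> z powr p"
proof (cases "z = 0")
  case False
  with assms have z: "z > 0" by simp
  have "(z powr p) powr (1 / p) * 1 powr (1 - 1 / p) \<le> 1 / p * z powr p + (1 - 1 / p) * 1"
    by (rule Youngs_inequality_0) (use assms z in auto)
  then have "z \<le> 1 / p * z powr p + (1 - 1 / p)"
    using assms z by (simp add: powr_powr)
  then have "p * z \<le> p * (1 / p * z powr p + (1 - 1 / p))"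
    using assms by (intro mult_left_mono) auto
  also have "\<dots> = z powr p + p - 1" using assms by (simp add: field_simps)
  finally show ?thesis by (simp add: algebra_simps)
qed (use assms in simp)

text \<open>Hoelder continuity on [0,1], one-sided. For p at most 1 it is subadditivity: t is at
  most t^p on [0,1], applied to b/a and (a-b)/a, which add up to 1. For larger p it is the tangent
  inequality at b/a times a^p, with Lipschitz constant p because a^(p-1) is at most 1.\<close>

lemma powr_le_powr_add:
  fixes a b p :: real
  assumes p: "p > 0" and ab: "0 \<le> a" "a \<le> 1" "0 \<le> b"
  shows "a powr p \<le> b powr p + max 1 p * \<bar>a - b\<bar> powr min 1 p"
proof (cases "a \<le> b")
  case True
  then have "a powr p \<le> b powr p" using p ab by (intro powr_mono2) auto
  then show ?thesis by (rule order_trans) (use p in simp)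
next
  case False
  then have a: "a > 0" "b < a" using ab by auto
  show ?thesis
  proof (cases "p \<le> 1")
    case True
    have le: "t \<le> t powr p" if "0 \<le> t" "t \<le> 1" for t :: real
      using powr_mono'[of p 1 t] that p True by (cases "t = 0") auto
    have "1 = b / a + (a - b) / a" using a by (simp add: field_simps)
    also have "\<dots> \<le> (b / a) powr p + ((a - b) / a) powr p"
      by (intro add_mono le) (use a ab in auto)
    finally have "a powr p * 1 \<le> a powr p * ((b / a) powr p + ((a - b) / a) powr p)"
      by (rule mult_left_mono) simp
    also have "\<dots> = b powr p + (a - b) powr p"
      using a ab by (simp add: powr_divide distrib_left)
    finally show ?thesis using True a p by (simp add: max_absorb1 min_absorb2)
  next
    case False
    have "a powr p * (1 + p * (b / a - 1)) \<le> a powr p * (b / a) powr p"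
      by (intro mult_left_mono powr_tangent_le) (use a ab False in auto)
    also have "\<dots> = b powr p" using a ab by (simp add: powr_divide)
    also have "a powr p * (1 + p * (b / a - 1)) = a powr p - p * (a powr (p - 1) * (a - b))"
      using a by (simp add: powr_diff field_simps)
    finally have "a powr p \<le> b powr p + p * (a powr (p - 1) * (a - b))" by simp
    also have "a powr (p - 1) * (a - b) \<le> 1 * (a - b)"
      by (intro mult_right_mono powr_le1) (use a ab False in auto)
    finally show ?thesis using False a p by (simp add: max_def min_def)
  qed
qed

text \<open>A configuration that is good on the net is good on the sphere: passing from
  \<open>v\<close> to a net point with coordinates within \<open>1 / m\<close> moves every inner
  product by at most \<open>d / m\<close>, and \<open>powr_le_powr_add\<close> bounds the change of
  each summand.\<close>

lemma polarization_const_le_net: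
  assumes p: "p > 0" and pos: "d > 0" "n > 0" "m > (0::nat)" "\<epsilon> > 0"
    and small: "(2 * real m + 1) ^ d * exp (- 2 * real n * \<epsilon>\<^sup>2) < 1"
  shows "polarization_const p d n \<le> real n * (mu d p + \<epsilon> + max 1 p * (real d / real m) powr min 1 p)"
proof -
  obtain T where T: "finite T" "T \<subseteq> unit_sphere d" "card T \<le> (2 * m + 1) ^ d"
    "\<And>v. v \<in> unit_sphere d \<Longrightarrow> \<exists>t\<in>T. \<forall>i<d. \<bar>v i - t i\<bar> \<le> 1 / real m"
    using unit_sphere_net[OF pos(1,3)] by blast
  have "real (card T) \<le> real ((2 * m + 1) ^ d)" using T(3) by (rule of_nat_mono)
  also have "\<dots> = (2 * real m + 1) ^ d" by (simp add: add.commute)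
  finally have "real (card T) * exp (- 2 * real n * \<epsilon>\<^sup>2) \<le> (2 * real m + 1) ^ d * exp (- 2 * real n * \<epsilon>\<^sup>2)"
    by (rule mult_right_mono) simp
  also note small
  finally obtain u where u: "\<And>i. u i \<in> unit_sphere d"
    "\<And>v. v \<in> T \<Longrightarrow> lp_potential p d n u v \<le> real n * (mu d p + \<epsilon>)"
    using exists_points_small_potential[OF p pos(1,2,4) T(1,2)] by blast
  show ?thesis
  proof (rule polarization_const_le[OF p pos(1) u(1)])
    fix v assume v: "v \<in> unit_sphere d"
    obtain t where t: "t \<in> T" "\<And>i. i < d \<Longrightarrow> \<bar>v i - t i\<bar> \<le> 1 / real m" using T(4)[OF v] by blast
    have t': "t \<in> unit_sphere d" using t T by blast
    define D where "D = max 1 p * (real d / real m) powr min 1 p"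
    have "\<bar>dot d v (u i)\<bar> powr p \<le> \<bar>dot d t (u i)\<bar> powr p + D" for i
    proof -
      have coord: "\<bar>u i j\<bar> \<le> 1" if "j < d" for j
      proof -
        have "(u i j)\<^sup>2 \<le> (\<Sum>j<d. (u i j)\<^sup>2)" using that by (intro member_le_sum) auto
        then show ?thesis using u(1)[of i] by (simp add: unit_sphere_def abs_square_le_1)
      qed
      have "\<bar>\<bar>dot d v (u i)\<bar> - \<bar>dot d t (u i)\<bar>\<bar> \<le> \<bar>dot d v (u i) - dot d t (u i)\<bar>"
        by (rule abs_triangle_ineq3)
      also have "dot d v (u i) - dot d t (u i) = (\<Sum>j<d. (v j - t j) * u i j)"
        by (simp add: dot_def sum_subtractf left_diff_distrib)
      also have "\<bar>\<dots>\<bar> \<le> (\<Sum>j<d. \<bar>(v j - t j) * u i j\<bar>)" by (rule sum_abs)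
      \<comment> \<open>Bounding the coordinates of \<open>u i\<close> by 1 loses a factor of order
        sqrt(d) against Cauchy-Schwarz; this is harmless, as \<open>m\<close> will be a large power
        of \<open>d\<close>.\<close>
      also have "\<dots> \<le> (\<Sum>j<d. 1 / real m * 1)"
        unfolding abs_mult by (intro sum_mono mult_mono t coord) auto
      also have "\<dots> = real d / real m" by simp
      finally have le: "\<bar>\<bar>dot d v (u i)\<bar> - \<bar>dot d t (u i)\<bar>\<bar> \<le> real d / real m" .
      have "\<bar>dot d v (u i)\<bar> powr p \<le> \<bar>dot d t (u i)\<bar> powr p
          + max 1 p * \<bar>\<bar>dot d v (u i)\<bar> - \<bar>dot d t (u i)\<bar>\<bar> powr min 1 p"
        by (rule powr_le_powr_add) (use p abs_dot_le_1[OF v u(1)] in auto)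
      also have "\<dots> \<le> \<bar>dot d t (u i)\<bar> powr p + D"
        unfolding D_def using le p by (intro add_left_mono mult_left_mono powr_mono2) auto
      finally show ?thesis .
    qed
    then have "lp_potential p d n u v \<le> (\<Sum>i<n. \<bar>dot d t (u i)\<bar> powr p + D)"
      unfolding lp_potential_def by (intro sum_mono)
    also have "\<dots> = lp_potential p d n u t + real n * D" by (simp add: lp_potential_def sum.distrib)
    also have "\<dots> \<le> real n * (mu d p + \<epsilon>) + real n * D" using u(2)[OF t(1)] by simp
    finally show "lp_potential p d n u v \<le> real n * (mu d p + \<epsilon> + D)" by (simp add: algebra_simps)
  qed
qed

subsection \<open>Explicit bounds\<close>

text \<open>At the integer shift \<open>k\<close> the quotient of Gamma values is a Pochhammer
  product of \<open>k\<close> factors, each at most \<open>x + k\<close>. Log-convexity interpolates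
  between the shifts 0 and \<open>k\<close> with weight \<open>a / k\<close>, which turns the
  exponent \<open>k\<close> into \<open>a\<close>.\<close>

lemma Gamma_add_le:
  fixes x a :: real
  assumes x: "x > 0" and a: "0 \<le> a" "a \<le> real k" and k: "k > 0"
  shows "Gamma (x + a) \<le> Gamma x * (x + real k) powr a"
proof -
  define t where "t = a / real k"
  have t: "0 \<le> t" "t \<le> 1" "t * real k = a" using a k by (auto simp: t_def)
  have G: "Gamma x > 0" "Gamma (x + a) > 0" "Gamma (x + real k) > 0" using x a by (auto intro!: Gamma_real_pos)
  have "pochhammer x k = (\<Prod>i=0..<k. x + real i)" by (simp add: pochhammer_prod)
  also have "\<dots> \<le> (\<Prod>i=0..<k. x + real k)" using x by (intro prod_mono) auto
  finally have poch: "pochhammer x k \<le> (x + real k) ^ k" by simp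
  have "x \<notin> \<int>\<^sub>\<le>\<^sub>0" using x by (auto elim!: nonpos_Ints_cases')
  then have "pochhammer x k = Gamma (x + real k) / Gamma x" by (rule pochhammer_Gamma)
  with poch G have "Gamma (x + real k) \<le> Gamma x * (x + real k) ^ k" by (simp add: field_simps)
  then have "ln (Gamma (x + real k)) \<le> ln (Gamma x * (x + real k) ^ k)" using G by simp
  also have "\<dots> = ln (Gamma x) + real k * ln (x + real k)"
    using G(1)[THEN less_imp_neq] x by (subst ln_mult) (auto simp: ln_realpow)
  finally have ln_k: "ln (Gamma (x + real k)) \<le> ln (Gamma x) + real k * ln (x + real k)" .
  have "(ln \<circ> Gamma) ((1 - t) *\<^sub>R x + t *\<^sub>R (x + real k)) \<le> (1 - t) * (ln \<circ> Gamma) x + t * (ln \<circ> Gamma) (x + real k)"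
    by (rule convex_onD[OF log_convex_Gamma_real]) (use t x in auto)
  also have "(1 - t) *\<^sub>R x + t *\<^sub>R (x + real k) = x + t * real k" by (simp add: algebra_simps)
  also have "\<dots> = x + a" by (simp only: t)
  finally have "ln (Gamma (x + a)) \<le> (1 - t) * ln (Gamma x) + t * ln (Gamma (x + real k))" by simp
  also have "\<dots> \<le> (1 - t) * ln (Gamma x) + t * (ln (Gamma x) + real k * ln (x + real k))"
    using ln_k t by (intro add_left_mono mult_left_mono) auto
  also have "\<dots> = ln (Gamma x) + (t * real k) * ln (x + real k)" by (simp add: algebra_simps)
  also have "\<dots> = ln (Gamma x * (x + real k) powr a)" using G(1)[THEN less_imp_neq] x t by (subst ln_mult) (auto simp: ln_powr)
  finally show ?thesis using G x by simp
qed

text \<open>\<open>Gamma_add_le\<close> with x = d/2 and a = p/2 bounds the Gamma quotient in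
  \<open>mu\<close>; d/2 + k is at most d (k + 1/2) because d is at least 1, so the constant does
  not depend on d.\<close>

lemma mu_ge:
  assumes p: "p > 0"
  shows "\<exists>c>0. \<forall>d>0. c * real d powr (- p / 2) \<le> mu d p"
proof -
  \<comment> \<open>Any positive integer that is at least \<open>p / 2\<close> would do.\<close>
  define k where "k = Suc (nat \<lceil>p\<rceil>)"
  have k: "k > 0" "p / 2 \<le> real k" using p by (auto simp: k_def) linarith
  define c where "c = Gamma ((p + 1) / 2) / sqrt pi * (real k + 1/2) powr (- p / 2)"
  have "c * real d powr (- p / 2) \<le> mu d p" if d: "d > 0" for d
  proof -
    have G: "Gamma (real d / 2) > 0" "Gamma ((p + 1) / 2) > 0" "Gamma ((real d + p) / 2) > 0"
      using d p by (auto intro!: Gamma_real_pos)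
    define y where "y = (real d * (real k + 1/2)) powr (p / 2)"
    have y: "y > 0" using d by (simp add: y_def)
    have "real k * 1 \<le> real k * real d" using d by (intro mult_left_mono) auto
    then have "real d / 2 + real k \<le> real d * (real k + 1/2)" by (simp add: algebra_simps)
    then have "(real d / 2 + real k) powr (p / 2) \<le> y"
      unfolding y_def using p by (intro powr_mono2) auto
    then have "Gamma (real d / 2) * (real d / 2 + real k) powr (p / 2) \<le> Gamma (real d / 2) * y"
      using G by (intro mult_left_mono) auto
    moreover have "Gamma (real d / 2 + p / 2) \<le> Gamma (real d / 2) * (real d / 2 + real k) powr (p / 2)"
      by (rule Gamma_add_le) (use d p k in auto)
    ultimately have "Gamma ((real d + p) / 2) \<le> Gamma (real d / 2) * y" by (simp add: add_divide_distrib)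
    then have "1 / y \<le> Gamma (real d / 2) / Gamma ((real d + p) / 2)"
      using G y by (simp add: field_simps)
    then have "Gamma ((p + 1) / 2) / sqrt pi * (1 / y) \<le> Gamma ((p + 1) / 2) / sqrt pi * (Gamma (real d / 2) / Gamma ((real d + p) / 2))"
      using G by (intro mult_left_mono) auto
    also have "\<dots> = mu d p" by (simp add: mu_def)
    also have "1 / y = (real k + 1/2) powr (- p / 2) * real d powr (- p / 2)"
      using d by (simp add: y_def powr_mult powr_minus_divide)
    finally show ?thesis by (simp add: c_def mult.assoc)
  qed
  moreover have "c > 0" using p by (auto simp: c_def intro!: mult_pos_pos divide_pos_pos Gamma_real_pos)
  ultimately show ?thesis by blast
qed

lemma polarization_const_lower:
  assumes p: "p > 0"
  shows "\<exists>c>0. \<forall>d n. d > 0 \<longrightarrow> c * real n * real d powr (- p / 2) \<le> polarization_const p d n"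
proof -
  obtain c where c: "c > 0" "\<And>d. d > 0 \<Longrightarrow> c * real d powr (- p / 2) \<le> mu d p"
    using mu_ge[OF p] by blast
  have "c * real n * real d powr (- p / 2) \<le> polarization_const p d n" if "d > 0" for d n
  proof -
    have "real n * (c * real d powr (- p / 2)) \<le> real n * mu d p"
      using c(2)[OF that] by (intro mult_left_mono) auto
    also have "\<dots> \<le> polarization_const p d n" by (rule polarization_const_ge[OF p that])
    finally show ?thesis by (simp add: mult_ac)
  qed
  with c(1) show ?thesis by blast
qed

section \<open>Upper bounds from copies of the standard basis\<close>

lemma sum_mod_periods:
  fixes f :: "nat \<Rightarrow> real"
  shows "(\<Sum>i<k * d. f (i mod d)) = real k * (\<Sum>j<d. f j)"
proof -
  have "(\<Sum>i<k * d. f (i mod d)) = (\<Sum>m<k. \<Sum>i=m * d..<m * d + d. f (i mod d))"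
    by (rule sum.nat_group[symmetric])
  also have "\<dots> = (\<Sum>m<k. \<Sum>j<d. f j)"
  proof (rule sum.cong[OF refl])
    fix m
    have "(\<Sum>i=0 + m * d..<d + m * d. f (i mod d)) = (\<Sum>j=0..<d. f ((j + m * d) mod d))"
      by (rule sum.shift_bounds_nat_ivl)
    also have "\<dots> = (\<Sum>j<d. f j)" by (auto simp: lessThan_atLeast0)
    finally show "(\<Sum>i=m * d..<m * d + d. f (i mod d)) = (\<Sum>j<d. f j)" by (simp add: add.commute)
  qed
  finally show ?thesis by simp
qed

text \<open>The configuration runs cyclically through the basis vectors. Completing the last cycle
  only adds nonnegative terms, and since \<open>d \<le> n\<close> the number of cycles is at most
  \<open>2 * n / d\<close>, which accounts for the factor 2.\<close>

lemma polarization_const_le_repeated_basis: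
  assumes p: "p > 0" and d: "0 < d" "d \<le> n"
    and B: "\<And>v. v \<in> unit_sphere d \<Longrightarrow> (\<Sum>j<d. \<bar>v j\<bar> powr p) \<le> B"
  shows "polarization_const p d n \<le> 2 * real n / real d * B"
proof (rule polarization_const_le[OF p d(1)])
  define u where "u i j = (if j = i mod d then 1 else 0 :: real)" for i j :: nat
  show "u i \<in> unit_sphere d" for i
  proof -
    have "i mod d < d" using d by simp
    then have "(\<Sum>j<d. (u i j)\<^sup>2) = 1" by (simp add: u_def if_distrib[of "\<lambda>x. x\<^sup>2"] cong: if_cong)
    then show ?thesis using \<open>i mod d < d\<close> by (auto simp: unit_sphere_def topspace_Euclidean_space u_def)
  qed
  fix v assume v: "v \<in> unit_sphere d"
  define k where "k = n div d + 1"
  have "n < k * d" using d by (simp add: k_def dividend_less_div_times)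
  have "real (n div d) \<le> real n / real d" by (rule of_nat_div_le_of_nat)
  moreover have "1 \<le> real n / real d" using d by simp
  ultimately have k: "real k \<le> 2 * real n / real d" by (simp add: k_def)
  have S: "0 \<le> (\<Sum>j<d. \<bar>v j\<bar> powr p)" by (intro sum_nonneg) auto
  have "dot d v (u i) = v (i mod d)" for i
    using d by (simp add: dot_def u_def if_distrib[of "\<lambda>x. _ * x"] cong: if_cong)
  then have "lp_potential p d n u v = (\<Sum>i<n. \<bar>v (i mod d)\<bar> powr p)" by (simp add: lp_potential_def)
  also have "\<dots> \<le> (\<Sum>i<k * d. \<bar>v (i mod d)\<bar> powr p)"
    using \<open>n < k * d\<close> by (intro sum_mono2) auto
  also have "\<dots> = real k * (\<Sum>j<d. \<bar>v j\<bar> powr p)" by (rule sum_mod_periods)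
  also have "\<dots> \<le> 2 * real n / real d * B"
    by (intro mult_mono k B v S) auto
  finally show "lp_potential p d n u v \<le> 2 * real n / real d * B" .
qed

text \<open>The power mean inequality, with equality at vectors whose coordinates all have the same
  modulus. It follows from the weighted mean inequality for (v j)^2 and 1/d with weights p/2 and 1 -
  p/2, whose right-hand sides sum to 1.\<close>

lemma sum_abs_powr_le_small_exponent:
  assumes p: "0 < p" "p \<le> 2" and d: "d > 0" and v: "v \<in> unit_sphere d"
  shows "(\<Sum>j<d. \<bar>v j\<bar> powr p) \<le> real d powr (1 - p / 2)"
proof -
  have v1: "(\<Sum>j<d. (v j)\<^sup>2) = 1" using v by (simp add: unit_sphere_def)
  have "\<bar>v j\<bar> powr p * (1 / real d) powr (1 - p / 2) \<le> p / 2 * (v j)\<^sup>2 + (1 - p / 2) * (1 / real d)" for j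
  proof (cases "v j = 0")
    case True
    then show ?thesis using p by simp
  next
    case False
    have "((v j)\<^sup>2) powr (p / 2) * (1 / real d) powr (1 - p / 2) \<le> p / 2 * (v j)\<^sup>2 + (1 - p / 2) * (1 / real d)"
      by (rule Youngs_inequality_0) (use p d False in auto)
    also have "((v j)\<^sup>2) powr (p / 2) = (\<bar>v j\<bar> powr 2) powr (p / 2)" using False by simp
    also have "\<dots> = \<bar>v j\<bar> powr p" by (simp only: powr_powr) simp
    finally show ?thesis .
  qed
  then have "(\<Sum>j<d. \<bar>v j\<bar> powr p * (1 / real d) powr (1 - p / 2)) \<le> (\<Sum>j<d. p / 2 * (v j)\<^sup>2 + (1 - p / 2) * (1 / real d))"
    by (intro sum_mono)
  also have "\<dots> = p / 2 * (\<Sum>j<d. (v j)\<^sup>2) + (1 - p / 2)" using d by (simp add: sum.distrib sum_distrib_left)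
  also have "\<dots> = 1" by (simp add: v1)
  also have "(\<Sum>j<d. \<bar>v j\<bar> powr p * (1 / real d) powr (1 - p / 2)) = (\<Sum>j<d. \<bar>v j\<bar> powr p) / real d powr (1 - p / 2)"
    using d by (simp add: powr_divide sum_divide_distrib)
  finally show ?thesis using d by simp
qed

text \<open>Coordinates of a unit vector are at most 1 in modulus, so raising the exponent from 2 to
  \<open>p\<close> decreases each term; basis vectors give equality.\<close>

lemma sum_abs_powr_le_large_exponent:
  assumes p: "2 \<le> p" and v: "v \<in> unit_sphere d"
  shows "(\<Sum>j<d. \<bar>v j\<bar> powr p) \<le> 1"
proof -
  have "\<bar>v j\<bar> powr p \<le> (v j)\<^sup>2" if "j < d" for j
  proof -
    have "(v j)\<^sup>2 \<le> (\<Sum>j<d. (v j)\<^sup>2)" using that by (intro member_le_sum) auto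
    then have "\<bar>v j\<bar> \<le> 1" using v by (simp add: unit_sphere_def abs_square_le_1)
    then have "\<bar>v j\<bar> powr p \<le> \<bar>v j\<bar> powr 2" using p by (intro powr_mono') auto
    then show ?thesis by (cases "v j = 0") auto
  qed
  then have "(\<Sum>j<d. \<bar>v j\<bar> powr p) \<le> (\<Sum>j<d. (v j)\<^sup>2)" by (intro sum_mono) auto
  then show ?thesis using v by (simp add: unit_sphere_def)
qed

lemma polarization_const_upper_small_exponent:
  assumes p: "0 < p" "p \<le> 2" and d: "0 < d" "d \<le> n"
  shows "polarization_const p d n \<le> 2 * real n * real d powr (- p / 2)"
proof -
  have "polarization_const p d n \<le> 2 * real n / real d * real d powr (1 - p / 2)"
    by (intro polarization_const_le_repeated_basis sum_abs_powr_le_small_exponent p d)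
  also have "\<dots> = 2 * real n * real d powr (- p / 2)"
    using d by (simp add: powr_diff powr_minus_divide)
  finally show ?thesis .
qed

lemma polarization_const_upper_large_exponent:
  assumes p: "2 < p" and d: "0 < d" "d \<le> n"
  shows "polarization_const p d n \<le> 2 * real n * real d powr (- 1)"
proof -
  have "polarization_const p d n \<le> 2 * real n / real d * 1"
    by (intro polarization_const_le_repeated_basis sum_abs_powr_le_large_exponent) (use p d in auto)
  then show ?thesis using d by (simp add: powr_minus_divide)
qed

subsection \<open>Asymptotics\<close>

text \<open>Take the net with m = d^L and deviation \<open>\<delta>\<close> = e d^(-p/2). Hypothesis
  \<open>big\<close> says, after rearrangement, that the Hoeffding exponent 2 n
  \<open>\<delta>\<close>^2 exceeds (L + 2) d ln d, which bounds the logarithm of the size of the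
  net. Hypothesis \<open>L\<close> makes the Hoelder error at most \<open>\<delta>\<close>, so the
  total excess per point is at most 2 \<open>\<delta>\<close>.\<close>

lemma polarization_const_deviation_le:
  fixes L :: nat
  assumes p: "p > 0" and d: "2 \<le> d" and n: "n > 0" and e: "e > 0"
    and L: "max 1 p * real d powr (p / 2 - (real L - 1) * min 1 p) \<le> e"
    and big: "(real L + 2) / (2 * e\<^sup>2) < real n / (real d powr (1 + p) * ln (real d))"
  shows "\<bar>polarization_const p d n - real n * mu d p\<bar> / (real n * real d powr (- p / 2)) \<le> 2 * e"
proof -
  define D where "D = real d"
  define N where "N = real n"
  define \<delta> where "\<delta> = e * D powr (- p / 2)"
  have D: "2 \<le> D" "0 < D" using d by (auto simp: D_def)
  have lnD: "ln D > 0" using D by simp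
  have N: "N > 0" using n by (simp add: N_def)
  have \<delta>: "\<delta> > 0" using e D by (simp add: \<delta>_def)
  have \<delta>2: "\<delta>\<^sup>2 = e\<^sup>2 * D powr (- p)"
    by (simp add: \<delta>_def power_mult_distrib power2_eq_square flip: powr_add)
  have "(real L + 2) / (2 * e\<^sup>2) * (D powr (1 + p) * ln D) < N"
    using big D lnD by (simp add: pos_less_divide_eq flip: D_def N_def)
  then have "(real L + 2) * (D powr (1 + p) * ln D) < N * (2 * e\<^sup>2)"
    using e by (simp add: pos_divide_less_eq)
  then have "(real L + 2) * (D powr (1 + p) * ln D) * D powr (- p) < N * (2 * e\<^sup>2) * D powr (- p)"
    using D by (intro mult_strict_right_mono) auto
  also have "(real L + 2) * (D powr (1 + p) * ln D) * D powr (- p) = (real L + 2) * (D powr (1 + p) * D powr (- p)) * ln D"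
    by (simp only: mult_ac)
  also have "D powr (1 + p) * D powr (- p) = D" using D by (simp flip: powr_add)
  also have "N * (2 * e\<^sup>2) * D powr (- p) = 2 * N * \<delta>\<^sup>2" by (simp add: \<delta>2)
  finally have exponent: "(real L + 2) * D * ln D < 2 * N * \<delta>\<^sup>2" .
  \<comment> \<open>The 2 in \<open>L + 2\<close> arises here: since \<open>D \<ge> 2\<close>, the
    factor 4 is absorbed by \<open>D\<^sup>2\<close>.\<close>
  have "2 * D ^ L + 1 \<le> D\<^sup>2 * D ^ L"
  proof -
    have "1 \<le> D ^ L" using D by simp
    moreover have "2\<^sup>2 \<le> D\<^sup>2" using D by (intro power_mono) auto
    then have "4 * D ^ L \<le> D\<^sup>2 * D ^ L" using D by (intro mult_right_mono) auto
    ultimately show ?thesis by linarith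
  qed
  also have "D\<^sup>2 * D ^ L = D powr (real L + 2)"
    using D by (simp add: powr_add powr_realpow mult.commute)
  finally have "(2 * D ^ L + 1) ^ d \<le> (D powr (real L + 2)) ^ d"
    using D by (intro power_mono) auto
  also have "\<dots> = exp ((real L + 2) * D * ln D)"
    using D by (simp add: powr_def D_def flip: exp_of_nat_mult)
  finally have "(2 * real (d ^ L) + 1) ^ d * exp (- 2 * real n * \<delta>\<^sup>2) \<le> exp ((real L + 2) * D * ln D) * exp (- 2 * real n * \<delta>\<^sup>2)"
    by (intro mult_right_mono) (auto simp: D_def)
  also have "\<dots> < 1" using exponent by (simp add: N_def flip: exp_add)
  finally have small: "(2 * real (d ^ L) + 1) ^ d * exp (- 2 * real n * \<delta>\<^sup>2) < 1" .
  have "polarization_const p d n \<le> N * (mu d p + \<delta> + max 1 p * (D / real (d ^ L)) powr min 1 p)"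
    unfolding N_def D_def by (rule polarization_const_le_net) (use p d n \<delta> small in auto)
  also have "D / real (d ^ L) = D powr (1 - real L)"
    using D by (simp add: powr_diff powr_realpow flip: D_def)
  \<comment> \<open>Splitting off \<open>D powr (- p / 2)\<close> leaves the power that hypothesis
    \<open>L\<close> controls.\<close>
  also have "(D powr (1 - real L)) powr min 1 p = D powr (p / 2 - (real L - 1) * min 1 p) * D powr (- p / 2)"
    by (simp add: powr_powr algebra_simps flip: powr_add)
  also have "max 1 p * (D powr (p / 2 - (real L - 1) * min 1 p) * D powr (- p / 2)) \<le> \<delta>"
    unfolding \<delta>_def mult.assoc[symmetric] using L by (intro mult_right_mono) (auto simp: D_def)
  finally have "polarization_const p d n \<le> N * (mu d p + \<delta> + \<delta>)"
    using N by simp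
  then have "polarization_const p d n - N * mu d p \<le> 2 * e * (N * D powr (- p / 2))"
    by (simp add: \<delta>_def algebra_simps)
  \<comment> \<open>By the averaging bound the deviation is nonnegative, so the absolute value needs
    no second estimate.\<close>
  moreover have "N * mu d p \<le> polarization_const p d n"
    unfolding N_def by (rule polarization_const_ge) (use p d in auto)
  ultimately show ?thesis
    using N D by (simp add: pos_divide_le_eq flip: N_def D_def)
qed

theorem polarization_const_asymptotics:
  fixes d n :: "nat \<Rightarrow> nat"
  assumes p: "p > 0" and n: "\<And>k. n k > 0"
    and d: "filterlim d at_top sequentially"
    and growth: "filterlim (\<lambda>k. real (n k) / (real (d k) powr (1 + p) * ln (real (d k)))) at_top sequentially"
  shows "(\<lambda>k. \<bar>polarization_const p (d k) (n k) - real (n k) * mu (d k) p\<bar>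
              / (real (n k) * real (d k) powr (- p / 2))) \<longlonglongrightarrow> 0"
proof (rule LIMSEQ_I)
  fix \<epsilon> :: real assume \<epsilon>: "\<epsilon> > 0"
  \<comment> \<open>The deviation lemma yields the bound 2e, which must stay strictly below
    \<open>\<epsilon>\<close>.\<close>
  define e where "e = \<epsilon> / 3"
  have e: "e > 0" "2 * e < \<epsilon>" using \<epsilon> by (auto simp: e_def)
  define q where "q = min 1 p"
  have q: "q > 0" using p by (simp add: q_def)
  \<comment> \<open>\<open>L\<close> depends on \<open>p\<close> only and makes the exponent of
    \<open>d\<close> in the Hoelder error negative, so that this error is eventually below
    \<open>e\<close>.\<close>
  obtain L :: nat where "p / (2 * q) + 1 < real L" using reals_Archimedean2 by blast
  then have "p / 2 - (real L - 1) * q < 0" using q by (simp add: field_simps)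
  moreover have dr: "filterlim (\<lambda>k. real (d k)) at_top sequentially"
    by (rule filterlim_compose[OF filterlim_real_sequentially d])
  ultimately have "(\<lambda>k. real (d k) powr (p / 2 - (real L - 1) * q)) \<longlonglongrightarrow> 0"
    by (rule tendsto_neg_powr)
  then have "(\<lambda>k. max 1 p * real (d k) powr (p / 2 - (real L - 1) * q)) \<longlonglongrightarrow> 0"
    by (rule tendsto_mult_right_zero)
  then have "\<forall>\<^sub>F k in sequentially. max 1 p * real (d k) powr (p / 2 - (real L - 1) * q) < e"
    by (rule order_tendstoD) (rule e)
  moreover have "\<forall>\<^sub>F k in sequentially. 2 \<le> d k" using d by (simp add: filterlim_at_top)
  moreover have "\<forall>\<^sub>F k in sequentially. (real L + 2) / (2 * e\<^sup>2) < real (n k) / (real (d k) powr (1 + p) * ln (real (d k)))"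
    using growth by (simp add: filterlim_at_top_dense)
  ultimately have "\<forall>\<^sub>F k in sequentially. \<bar>polarization_const p (d k) (n k) - real (n k) * mu (d k) p\<bar>
              / (real (n k) * real (d k) powr (- p / 2)) \<le> 2 * e"
  proof eventually_elim
    case (elim k)
    show ?case
      by (rule polarization_const_deviation_le[where L = L]) (use elim p n e in \<open>auto simp: q_def\<close>)
  qed
  then have "\<forall>\<^sub>F k in sequentially. norm (\<bar>polarization_const p (d k) (n k) - real (n k) * mu (d k) p\<bar>
              / (real (n k) * real (d k) powr (- p / 2)) - 0) < \<epsilon>"
    by eventually_elim (use e in simp)
  then show "\<exists>K. \<forall>k\<ge>K. norm (\<bar>polarization_const p (d k) (n k) - real (n k) * mu (d k) p\<bar>
              / (real (n k) * real (d k) powr (- p / 2)) - 0) < \<epsilon>"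
    by (simp only: eventually_sequentially)
qed

theorem theorem1:
  fixes p :: real
  assumes "p > 0"
  shows
    "(\<forall>d n :: nat \<Rightarrow> nat.
        (\<forall>k. d k > 0) \<longrightarrow> (\<forall>k. n k > 0) \<longrightarrow>
        filterlim d at_top sequentially \<longrightarrow> filterlim n at_top sequentially \<longrightarrow>
        filterlim (\<lambda>k. real (n k) / (real (d k) powr (1 + p) * ln (real (d k)))) at_top sequentially \<longrightarrow>
        (\<lambda>k. \<bar>polarization_const p (d k) (n k) - real (n k) * mu (d k) p\<bar>
              / (real (n k) * real (d k) powr (- p / 2))) \<longlonglongrightarrow> 0)
     \<and> (p \<le> 2 \<longrightarrow>
          (\<exists>c C :: real. \<exists>N :: nat. c > 0 \<and> C > 0 \<and>
            (\<forall>d n :: nat. N \<le> d \<longrightarrow> d \<le> n \<longrightarrow>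
               c * real n * real d powr (- p / 2) \<le> polarization_const p d n \<and>
               polarization_const p d n \<le> C * real n * real d powr (- p / 2))))
     \<and> (p > 2 \<longrightarrow>
          (\<exists>c C :: real. \<exists>N :: nat. c > 0 \<and> C > 0 \<and>
            (\<forall>d n :: nat. N \<le> d \<longrightarrow> d \<le> n \<longrightarrow>
               c * real n * real d powr (- p / 2) \<le> polarization_const p d n \<and>
               polarization_const p d n \<le> C * real n * real d powr (- 1))))"
proof -
  obtain c where c: "c > 0"
    "\<And>d n. d > 0 \<Longrightarrow> c * real n * real d powr (- p / 2) \<le> polarization_const p d n"
    using polarization_const_lower[OF assms] by blast
  show ?thesis
  proof (intro conjI impI allI)
    fix d n :: "nat \<Rightarrow> nat"
    assume "\<forall>k. n k > 0" "filterlim d at_top sequentially"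
      "filterlim (\<lambda>k. real (n k) / (real (d k) powr (1 + p) * ln (real (d k)))) at_top sequentially"
    then show "(\<lambda>k. \<bar>polarization_const p (d k) (n k) - real (n k) * mu (d k) p\<bar>
              / (real (n k) * real (d k) powr (- p / 2))) \<longlonglongrightarrow> 0"
      by (intro polarization_const_asymptotics assms) auto
  next
    assume "p \<le> 2"
    show "\<exists>c C :: real. \<exists>N :: nat. c > 0 \<and> C > 0 \<and>
            (\<forall>d n :: nat. N \<le> d \<longrightarrow> d \<le> n \<longrightarrow>
               c * real n * real d powr (- p / 2) \<le> polarization_const p d n \<and>
               polarization_const p d n \<le> C * real n * real d powr (- p / 2))"
    \<comment> \<open>Unification with the claims below fixes the witnesses: the constant
      \<open>c\<close> of the averaging bound, \<open>C = 2\<close> and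
      \<open>N = 1\<close>.\<close>
    proof (intro exI conjI allI impI)
      fix d n :: nat
      assume "1 \<le> d" "d \<le> n"
      then show "c * real n * real d powr (- p / 2) \<le> polarization_const p d n"
        "polarization_const p d n \<le> 2 * real n * real d powr (- p / 2)"
        using c polarization_const_upper_small_exponent[of p d n] assms \<open>p \<le> 2\<close> by auto
    qed (use c in auto)
  next
    assume "p > 2"
    show "\<exists>c C :: real. \<exists>N :: nat. c > 0 \<and> C > 0 \<and>
            (\<forall>d n :: nat. N \<le> d \<longrightarrow> d \<le> n \<longrightarrow>
               c * real n * real d powr (- p / 2) \<le> polarization_const p d n \<and>
               polarization_const p d n \<le> C * real n * real d powr (- 1))"
    proof (intro exI conjI allI impI)
      fix d n :: nat
      assume "1 \<le> d" "d \<le> n"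
      then show "c * real n * real d powr (- p / 2) \<le> polarization_const p d n"
        "polarization_const p d n \<le> 2 * real n * real d powr (- 1)"
        using c polarization_const_upper_large_exponent[of p d n] \<open>p > 2\<close> by auto
    qed (use c in auto)
  qed
qed

end
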